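(* Let $G$ be a finite connected directed graph with nonnegative edge weights, embedded in the plane (multiple edges and self-loops allowed). Let $v^*$ be a vertex of $G$, let $f^*$ be a face of $G$ (possibly the unbounded face), and let $\mathcal{H}(v^*,f^* )$ be the weighted graph obtained from the vertex-edge-face graph $\mathcal{H}(G)$ by deleting the nodes $\overline{v^*}$ and $\overline{f^*}$ together with all links incident to them. (1) If $v^*$ is incident with $f^*$, then there is a weight-preserving bijection between the directed spanning trees of $G$ rooted at $v^*$ and the perfect matchings of $\mathcal{H}(v^*,f^* )$. (2) If $v^*$ is not incident with $f^*$, then there is a weight-preserving injection from the directed spanning trees of $G$ rooted at $v^*$ to the perfect matchings of $\mathcal{H}(v^*,f^* )$.
   Context: Weights and directions. Each directed edge of $G$ carries a nonnegative weight; the weight of a directed edge from $u$ to $v$ need not equal that of other directed edges from $u$ to $v$ or from $v$ to $u$. An undirected edge is regarded as two oppositely directed edges embedded so as to coincide in the plane; more generally two oppositely directed edges may be embedded so as to coincide, and then they count as one embedded edge $e$ carrying one weight for each direction. If an embedded edge $e$ is present in only one direction, the missing direction is regarded as having weight $0$. Weight-zero directed edges and weight-zero links are treated in the same way on both sides: either both are kept (so that trees may use weight-zero directions and matchings may use weight-zero links), or both are discarded. Unweighted graphs have all weights equal to $1$. Directed spanning tree. A directed spanning tree (arborescence) of $G$ rooted at $v^*$ is a connected, contractible union $T$ of directed edges of $G$ such that every vertex of $G$ other than $v^*$ has exactly one outgoing edge in $T$ (and $v^*$ has none). Its weight is the product of the weights of its directed edges. The graph $\mathcal{H}(G)$. Let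 $V$, $E$, $F$ be the sets of vertices, embedded edges and faces (including the unbounded face) of $G$. $\mathcal{H}(G)$ is the weighted undirected graph with one node $\overline{v}$ for each $v\in V$, one node $\overline{e}$ for each $e\in E$, and one node $\overline{f}$ for each $f\in F$. There is a link joining two nodes exactly when the corresponding structures in $G$ are either an edge and one of its endpoints, or an edge and one of the faces that it bounds. The weight of the link between $\overline{v}$ and $\overline{e}$ (with $v$ an endpoint of $e$) is the weight of the edge $e$ in the direction away from $v$. The weight of the link between $\overline{f}$ and $\overline{e}$ (with $e$ bounding $f$) is $1$. A perfect matching of a graph is a set of its edges such that each vertex of the graph lies in exactly one edge of the set; its weight is the product of the weights of its edges. A vertex is incident with a face if it lies on the boundary of that face. "Weight-preserving" means that corresponding objects have the same weight. *)

theory Defs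
  imports "HOL-Analysis.Analysis"
begin

(* A weighted directed multigraph drawn in the plane, listed by its embedded edges.
   An embedded edge e is traversed along (curve G e) in direction True and along the
   reversed curve in direction False; weight G e d is the weight of e in direction d,
   with value 0 for a direction that is missing. *)

record 'e plane_digraph =
  verts  :: "complex set"
  edges  :: "'e set"
  curve  :: "'e \<Rightarrow> real \<Rightarrow> complex"
  weight :: "'e \<Rightarrow> bool \<Rightarrow> real"

definition tail :: "'e plane_digraph \<Rightarrow> 'e \<Rightarrow> bool \<Rightarrow> complex" where
  "tail G e d = (if d then pathstart (curve G e) else pathfinish (curve G e))"

definition head :: "'e plane_digraph \<Rightarrow> 'e \<Rightarrow> bool \<Rightarrow> complex" where
  "head G e d = tail G e (\<not> d)"

(* simple_path allows the two endpoints of a curve to agree, so self-loops are included. *)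

definition finite_embedded :: "'e plane_digraph \<Rightarrow> bool" where
  "finite_embedded G \<longleftrightarrow>
     finite (verts G) \<and> finite (edges G) \<and>
     (\<forall>e \<in> edges G. simple_path (curve G e) \<and>
        path_image (curve G e) \<inter> verts G = {pathstart (curve G e), pathfinish (curve G e)}) \<and>
     (\<forall>e \<in> edges G. \<forall>e' \<in> edges G. e \<noteq> e' \<longrightarrow>
        path_image (curve G e) \<inter> path_image (curve G e') \<subseteq> verts G)"

definition nonneg_weights :: "'e plane_digraph \<Rightarrow> bool" where
  "nonneg_weights G \<longleftrightarrow> (\<forall>e \<in> edges G. \<forall>d. 0 \<le> weight G e d)"

(* The direction ranges over both values, so this is connectedness of the underlying
   undirected graph. *)

definition graph_connected :: "'e plane_digraph \<Rightarrow> bool" where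
  "graph_connected G \<longleftrightarrow>
     (\<forall>u \<in> verts G. \<forall>v \<in> verts G.
        (u, v) \<in> {(tail G e d, head G e d) | e d. e \<in> edges G}\<^sup>*)"

definition faces :: "'e plane_digraph \<Rightarrow> complex set set" where
  "faces G = components (- (verts G \<union> (\<Union>e \<in> edges G. path_image (curve G e))))"

definition vertex_incident :: "complex \<Rightarrow> complex set \<Rightarrow> bool" where
  "vertex_incident v f \<longleftrightarrow> v \<in> frontier f"

definition edge_bounds :: "'e plane_digraph \<Rightarrow> 'e \<Rightarrow> complex set \<Rightarrow> bool" where
  "edge_bounds G e f \<longleftrightarrow> path_image (curve G e) \<subseteq> frontier f"

(* The argument keep0 selects one of the two conventions for weight zero: if it holds,
   directed edges and links of weight 0 may be used; otherwise both are discarded.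

   Every vertex other than the root is the tail of a member of T, so adding verts G to the
   union of the curves only makes sure that the root belongs to the tree. *)

definition spanning_trees ::
    "bool \<Rightarrow> 'e plane_digraph \<Rightarrow> complex \<Rightarrow> ('e \<times> bool) set set" where
  "spanning_trees keep0 G r =
     {T. T \<subseteq> {(e, d). e \<in> edges G \<and> (keep0 \<or> weight G e d \<noteq> 0)} \<and>
         connected (verts G \<union> (\<Union>(e, d) \<in> T. path_image (curve G e))) \<and>
         contractible (verts G \<union> (\<Union>(e, d) \<in> T. path_image (curve G e))) \<and>
         (\<forall>v \<in> verts G - {r}. \<exists>!(e, d). (e, d) \<in> T \<and> tail G e d = v) \<and>
         (\<forall>(e, d) \<in> T. tail G e d \<noteq> r)}"

definition tree_weight :: "'e plane_digraph \<Rightarrow> ('e \<times> bool) set \<Rightarrow> real" where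
  "tree_weight G T = (\<Prod>(e, d) \<in> T. weight G e d)"

record 'n wgraph =
  nodes       :: "'n set"
  links       :: "'n set set"
  link_weight :: "'n set \<Rightarrow> real"

definition delete_nodes :: "'n wgraph \<Rightarrow> 'n set \<Rightarrow> 'n wgraph" where
  "delete_nodes H X =
     H\<lparr>nodes := nodes H - X, links := {L \<in> links H. L \<inter> X = {}}\<rparr>"

definition perfect_matchings :: "'n wgraph \<Rightarrow> 'n set set set" where
  "perfect_matchings H = {M. M \<subseteq> links H \<and> (\<forall>x \<in> nodes H. \<exists>!L. L \<in> M \<and> x \<in> L)}"

definition matching_weight :: "'n wgraph \<Rightarrow> 'n set set \<Rightarrow> real" where
  "matching_weight H M = (\<Prod>L \<in> M. link_weight H L)"

datatype 'e node = VNode complex | ENode 'e | FNode "complex set"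

(* On the link between v and e the set below is the set of weights of e in the directions
   away from v. It is a singleton unless e is a self-loop, for which both directions lead
   away from v; taking the maximum gives the right value for a self-loop with only one
   direction (the missing one has weight 0) and for an undirected self-loop. *)

definition vef_weight :: "'e plane_digraph \<Rightarrow> 'e node set \<Rightarrow> real" where
  "vef_weight G L =
     (if \<exists>v. VNode v \<in> L
      then Max {weight G e d | e d. ENode e \<in> L \<and> VNode (tail G e d) \<in> L}
      else 1)"

definition vef_graph :: "bool \<Rightarrow> 'e plane_digraph \<Rightarrow> 'e node wgraph" where
  "vef_graph keep0 G =
     \<lparr>nodes = VNode ` verts G \<union> ENode ` edges G \<union> FNode ` faces G,
      links = {L. (L \<in> {{VNode (tail G e d), ENode e} | e d. e \<in> edges G} \<union>
                        {{FNode f, ENode e} | f e. f \<in> faces G \<and> e \<in> edges G \<and> edge_bounds G e f})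
                  \<and> (keep0 \<or> vef_weight G L \<noteq> 0)},
      link_weight = vef_weight G\<rparr>"

definition vef_graph_minus ::
    "bool \<Rightarrow> 'e plane_digraph \<Rightarrow> complex \<Rightarrow> complex set \<Rightarrow> 'e node wgraph" where
  "vef_graph_minus keep0 G v f = delete_nodes (vef_graph keep0 G) {VNode v, FNode f}"

end

theory Submission imports Defs "HOL-Complex_Analysis.Contour_Integration" begin

text \<open>Let \<open>A\<close> be the edge set of a spanning tree.  Its drawing is contractible, so its complement is
  connected, while adding any further edge closes a circuit and separates the plane.  Hence the
  remaining edges form a minimal connecting set of the faces, that is, a spanning tree of the dual
  graph.  Match each vertex other than \<open>v*\<close> with its out-edge, and each face other than \<open>f*\<close> with the
  first edge on its dual path to \<open>f*\<close>; this dual orientation is forced, so the map is injective.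
  Conversely, a perfect matching chooses an out-edge at every vertex other than \<open>v*\<close>.  If these edges
  did not form a tree, they would contain a circuit, and Euler's formula shows that the side of it away
  from \<open>v*\<close> and \<open>f*\<close>, which lie together, has one node too many to be matched.

  Two facts about plane curves keep this rigorous for wild arcs: an edge that meets the boundary of a
  face lies in it entirely, and it bounds at most two faces.  Both come from Janiszewski's theorem.\<close>

section \<open>Connectivity by cuts\<close>

text \<open>Faces are bare components of an open set. Their number is not known in advance, and arcs
  may oscillate, so there is no rotation system and no drawing of the dual to argue with. The dual
  graph is therefore just the incidence \<open>sides\<close>, and whatever topology has to say about
  it is said by cuts; the same notion serves the graph itself with \<open>ends\<close>. A tree is a
  connected graph whose edges are exhausted by one chosen out-edge per non-root node. Injectivity
  and uniqueness of such choices then need no counting, and the finiteness of the set of faces comes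
  out together with Euler's formula. The converse cannot run through the dual tree, because a
  matching carries no connectivity; this is why Euler's formula is compared for three graphs there:
  a unicyclic component of the chosen edges, the whole graph, and the whole graph with one side of
  that component erased.\<close>

definition cut_connected :: "'n set \<Rightarrow> 'd set \<Rightarrow> ('d \<Rightarrow> 'n set) \<Rightarrow> bool" where
  "cut_connected N D B \<longleftrightarrow>
     (\<forall>S \<subseteq> N. S \<noteq> {} \<longrightarrow> S \<noteq> N \<longrightarrow> (\<exists>e \<in> D. \<exists>x \<in> B e \<inter> S. \<exists>y \<in> B e. y \<notin> S))"

lemma cut_connectedD:
  assumes "cut_connected N D B" "S \<subseteq> N" "S \<noteq> {}" "S \<noteq> N"
  obtains e x y where "e \<in> D" "x \<in> B e" "y \<in> B e" "x \<in> S" "y \<notin> S"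
  using assms unfolding cut_connected_def by blast

text \<open>The absence of crossing edges is symmetric in a set and its complement, as long as all
  ends lie in \<open>N\<close>, so the side containing \<open>r\<close> can always be traded for the
  other one.\<close>

lemma not_cut_connectedE:
  assumes "\<not> cut_connected N D B" "r \<in> N" "\<And>e. e \<in> D \<Longrightarrow> B e \<subseteq> N"
  obtains S where "S \<subseteq> N" "S \<noteq> {}" "r \<notin> S" "\<And>e x y. e \<in> D \<Longrightarrow> x \<in> B e \<Longrightarrow> y \<in> B e \<Longrightarrow> x \<in> S \<Longrightarrow> y \<in> S"
proof -
  obtain S where S: "S \<subseteq> N" "S \<noteq> {}" "S \<noteq> N" 
    "\<And>e x y. e \<in> D \<Longrightarrow> x \<in> B e \<Longrightarrow> y \<in> B e \<Longrightarrow> x \<in> S \<Longrightarrow> y \<in> S"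
    using assms(1) unfolding cut_connected_def by blast
  show thesis
  proof (cases "r \<in> S")
    case False
    then show thesis using S that by blast
  next
    case True
    show thesis
    proof (rule that[of "N - S"])
      fix e x y assume "e \<in> D" "x \<in> B e" "y \<in> B e" "x \<in> N - S"
      then show "y \<in> N - S" using S(4) assms(3) by blast
    qed (use S True in auto)
  qed
qed

lemma minimal_cut_connected:
  assumes "finite D" "cut_connected N D B"
  obtains A where "A \<subseteq> D" "cut_connected N A B" "\<And>e. e \<in> A \<Longrightarrow> \<not> cut_connected N (A - {e}) B"
proof -
  let ?P = "\<lambda>A. A \<subseteq> D \<and> cut_connected N A B"
  obtain A where A: "?P A" "\<And>A'. ?P A' \<Longrightarrow> card A \<le> card A'"
    using ex_has_least_nat[of ?P D card] assms by blast
  show thesis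
  proof (rule that[of A])
    fix e assume e: "e \<in> A"
    then have "card (A - {e}) < card A"
      using A(1) assms(1) by (meson card_Diff1_less finite_subset)
    then show "\<not> cut_connected N (A - {e}) B" using A by (meson Diff_subset leD order_trans)
  qed (use A in auto)
qed

text \<open>Each edge of a minimal connecting set is the only one crossing some cut that leaves the
  root on the other side; it is matched with its end on the far side of that cut.\<close>

lemma minimal_cut_connected_matching:
  assumes conn: "cut_connected N D B" and r: "r \<in> N"
    and B: "\<And>e. e \<in> D \<Longrightarrow> B e \<subseteq> N" "\<And>e. e \<in> D \<Longrightarrow> \<exists>x y. B e = {x, y}"
    and minimal: "\<And>e. e \<in> D \<Longrightarrow> \<not> cut_connected N (D - {e}) B"
  obtains q where "bij_betw q (N - {r}) D" "\<And>n. n \<in> N - {r} \<Longrightarrow> n \<in> B (q n)"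
proof -
  have "\<exists>S. S \<subseteq> N \<and> S \<noteq> {} \<and> r \<notin> S \<and>
          (\<forall>d\<in>D - {e}. \<forall>x\<in>B d. \<forall>y\<in>B d. x \<in> S \<longrightarrow> y \<in> S)" if "e \<in> D" for e
    by (rule not_cut_connectedE[OF minimal[OF that] r]) (use B in blast)+
  then obtain S where S: "\<And>e. e \<in> D \<Longrightarrow> S e \<subseteq> N \<and> S e \<noteq> {} \<and> r \<notin> S e"
    and only: "\<And>e d x y. e \<in> D \<Longrightarrow> d \<in> D \<Longrightarrow> d \<noteq> e \<Longrightarrow> x \<in> B d \<Longrightarrow> y \<in> B d \<Longrightarrow> x \<in> S e \<Longrightarrow> y \<in> S e"
    by (metis Diff_iff singletonD)
  have "\<exists>x y. B e = {x, y} \<and> x \<in> S e \<and> y \<notin> S e" if e: "e \<in> D" for e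
  proof -
    obtain d x y where "d \<in> D" "x \<in> B d" "y \<in> B d" "x \<in> S e" "y \<notin> S e"
      using cut_connectedD[OF conn, of "S e"] S[OF e] r by metis
    moreover from this have "d = e" using only[OF e] by blast
    moreover obtain u v where "B e = {u, v}" using B(2)[OF e] by blast
    ultimately have "B e = {x, y}" by auto
    with \<open>x \<in> S e\<close> \<open>y \<notin> S e\<close> show ?thesis by blast
  qed
  then obtain far near where fn: "\<And>e. e \<in> D \<Longrightarrow> B e = {far e, near e} \<and> far e \<in> S e \<and> near e \<notin> S e"
    by metis
  have "inj_on far D"
  proof (rule inj_onI, rule ccontr)
    fix d e assume de: "d \<in> D" "e \<in> D" "far d = far e" "d \<noteq> e"
    \<comment> \<open>Only \<open>d\<close> or \<open>e\<close> can leave the union of the two far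
      sides. But the common far end lies in both sides, \<open>d\<close> does not cross
      \<open>S e\<close> and \<open>e\<close> does not cross \<open>S d\<close>, so each of the two
      edges stays inside the union.\<close>
    obtain c x y where c: "c \<in> D" "x \<in> B c" "y \<in> B c" "x \<in> S d \<union> S e" "y \<notin> S d \<union> S e"
      using cut_connectedD[OF conn, of "S d \<union> S e"] S de r
      by (metis Un_empty Un_iff Un_least)
    then have "c = d \<or> c = e" using only de by blast
    moreover have "far d \<in> B d" "far d \<in> S e" "far e \<in> B e" "far e \<in> S d"
      using fn[OF de(1)] fn[OF de(2)] de(3) by auto
    then have "B d \<subseteq> S e" "B e \<subseteq> S d"
      using only[of e d "far d"] only[of d e "far e"] de by blast+
    ultimately show False using c by auto
  qed
  moreover have "far ` D = N - {r}"
  proof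
    show "far ` D \<subseteq> N - {r}" using fn S by fast
    show "N - {r} \<subseteq> far ` D"
    proof (rule subsetI, rule ccontr)
      fix n assume "n \<in> N - {r}" and n_far: "n \<notin> far ` D"
      then have n: "n \<in> N" "n \<noteq> r" "n \<notin> far ` D" by auto
      \<comment> \<open>If \<open>n\<close> is the far end of no edge, it is the near end of all its
        edges. Then \<open>n\<close> together with the far sides of these edges omits the root, yet
        no edge can leave it.\<close>
      let ?Q = "insert n (\<Union>e\<in>{e \<in> D. n \<in> B e}. S e)"
      have "?Q \<subseteq> N" "?Q \<noteq> N" using n S r by blast+
      with cut_connectedD[OF conn, of ?Q]
      obtain d x y where d: "d \<in> D" "x \<in> B d" "y \<in> B d" "x \<in> ?Q" "y \<notin> ?Q"
        by blast
      have ends: "B e \<subseteq> ?Q" if "e \<in> D" "n \<in> B e" for e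
      proof -
        have "B e = {far e, near e}" "far e \<in> S e" "far e \<noteq> n" using fn[OF that(1)] that n(3) by blast+
        then have "B e = {far e, n}" using that(2) by auto
        with \<open>far e \<in> S e\<close> that show ?thesis by blast
      qed
      show False
      proof (cases "x = n")
        case True
        then show False using ends d by blast
      next
        case False
        then obtain e where "e \<in> D" "n \<in> B e" "x \<in> S e" using d by blast
        then show False using only[of e d x y] ends d by blast
      qed
    qed
  qed
  ultimately have far: "bij_betw far D (N - {r})" by (simp add: bij_betw_def)
  show thesis
  proof (rule that)
    show "bij_betw (the_inv_into D far) (N - {r}) D" using far by (rule bij_betw_the_inv_into)
    fix n assume "n \<in> N - {r}"
    then have "the_inv_into D far n \<in> D" "far (the_inv_into D far n) = n"
      using far by (auto simp: bij_betw_def f_the_inv_into_f the_inv_into_into)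
    then show "n \<in> B (the_inv_into D far n)" using fn by (metis insertI1)
  qed
qed

section \<open>Out-edges directed towards a root\<close>

inductive_set rooted :: "'n set \<Rightarrow> 'n \<Rightarrow> ('d \<Rightarrow> 'n set) \<Rightarrow> ('n \<Rightarrow> 'd) \<Rightarrow> 'n set"
  for N r B p where
  root: "r \<in> rooted N r B p"
| step: "n \<in> N - {r} \<Longrightarrow> m \<in> rooted N r B p \<Longrightarrow> B (p n) = {n, m} \<Longrightarrow> m \<noteq> n \<Longrightarrow> n \<in> rooted N r B p"

text \<open>Only surjectivity of \<open>p\<close> onto the edges is assumed. That the out-edges are
  distinct and are not loops follows from connectivity, even for infinite \<open>N\<close>. The
  locale is instantiated both with vertices and \<open>ends\<close> and with faces and
  \<open>sides\<close>.\<close>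

locale out_edges =
  fixes N :: "'n set" and D :: "'d set" and B :: "'d \<Rightarrow> 'n set" and r :: 'n and p :: "'n \<Rightarrow> 'd"
  assumes conn: "cut_connected N D B" and r: "r \<in> N"
    and B: "\<And>e. e \<in> D \<Longrightarrow> B e \<subseteq> N" "\<And>e. e \<in> D \<Longrightarrow> \<exists>x y. B e = {x, y}"
    and onto: "p ` (N - {r}) = D" and out: "\<And>n. n \<in> N - {r} \<Longrightarrow> n \<in> B (p n)"
begin

text \<open>An edge leaving the rooted set is the out-edge of one of its two ends. If this is the
  outer end, that node is one step from the rooted set and belongs to it; if it is the inner end,
  its out-edge leads to a rooted node and not outside.\<close>

lemma rooted_eq: "rooted N r B p = N"
proof (rule ccontr)
  let ?R = "rooted N r B p"
  have sub: "?R \<subseteq> N"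
  proof
    fix x assume "x \<in> ?R" then show "x \<in> N" by induction (use r in auto)
  qed
  assume "?R \<noteq> N"
  then obtain e x y where e: "e \<in> D" "x \<in> B e" "y \<in> B e" "x \<in> ?R" "y \<notin> ?R"
    using cut_connectedD[OF conn sub] root by (metis empty_iff)
  then have Be: "B e = {x, y}" "x \<noteq> y" using B(2)[of e] by auto
  obtain n where n: "n \<in> N - {r}" "e = p n" using e(1) onto by blast
  with out Be have "n = x \<or> n = y" by auto
  then show False
  proof
    assume "n = x"
    from e(4) show False
      by cases (use Be n \<open>n = x\<close> e in \<open>auto simp: doubleton_eq_iff\<close>)
  next
    assume "n = y"
    then show False using step[of y N r x B p] Be n e by (auto simp: insert_commute)
  qed
qed

lemma out_edge_cases:
  assumes "n \<in> N - {r}"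
  obtains m where "m \<in> N" "m \<noteq> n" "B (p n) = {n, m}"
proof -
  have "n \<in> rooted N r B p" using assms rooted_eq by blast
  then show thesis by cases (use assms that rooted_eq in auto)
qed

text \<open>Two nodes sharing an out-edge point at each other, so neither can be the first of the
  two to be rooted.\<close>

lemma inj_out: "inj_on p (N - {r})"
proof (rule inj_onI, rule ccontr)
  fix v w assume vw: "v \<in> N - {r}" "w \<in> N - {r}" "p v = p w" "v \<noteq> w"
  then have "v \<in> B (p v)" "w \<in> B (p v)" "p v \<in> D" using out[of v] out[of w] onto by auto
  moreover from this obtain x y where "B (p v) = {x, y}" using B(2) by blast
  ultimately have Bv: "B (p v) = {v, w}" using vw(4) by auto
  have "x \<notin> {v, w}" if "x \<in> rooted N r B p" for x
    using that
  proof induction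
    case root then show ?case using vw by auto
  next
    case (step n m)
    have "n \<noteq> v" "n \<noteq> w"
      using step.hyps(3,4) step.IH Bv vw(3) by (metis doubleton_eq_iff insertCI)+
    then show ?case by simp
  qed
  then show False using rooted_eq vw by blast
qed

text \<open>Induction outwards from the root: \<open>p n\<close> joins \<open>n\<close> to a parent
  \<open>m\<close> and is \<open>q k\<close> for one of these two nodes. The case
  \<open>k = m\<close> is impossible, since \<open>q m = p m\<close> by induction and
  \<open>p\<close> is injective.\<close>

lemma out_unique:
  assumes "q ` (N - {r}) = D" "\<And>n. n \<in> N - {r} \<Longrightarrow> n \<in> B (q n)" "n \<in> N - {r}"
  shows "q n = p n"
proof -
  interpret q: out_edges N D B r q using assms B conn r by unfold_locales auto
  have "x \<noteq> r \<longrightarrow> q x = p x" if "x \<in> rooted N r B p" for x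
    using that
  proof induction
    case (step n m)
    then have "p n \<in> q ` (N - {r})" using q.onto onto by blast
    then obtain k where k: "k \<in> N - {r}" "p n = q k" by blast
    then have "k = n \<or> k = m" using q.out[of k] step by auto
    moreover have "k \<noteq> m"
    proof
      assume "k = m"
      then have "p n = p m" using k step by auto
      then show False using inj_out step k \<open>k = m\<close> by (auto dest: inj_onD)
    qed
    ultimately show ?case using k by auto
  qed simp
  then show ?thesis using assms(3) rooted_eq by blast
qed

end

section \<open>Arcs and components of their complements\<close>

text \<open>On a nonempty interior the inverse parametrization would embed an open set of the plane
  into the line, against invariance of dimension.\<close>

lemma interior_arc_image_empty:
  fixes g :: "real \<Rightarrow> complex"
  assumes "arc g"
  shows "interior (path_image g) = {}"
proof (rule ccontr)
  assume ne: "interior (path_image g) \<noteq> {}"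
  obtain h where h: "homeomorphism {0..1} (path_image g) g h"
    using assms homeomorphism_arc by metis
  have "DIM(complex) \<le> DIM(real)"
  proof (rule invariance_of_dimension)
    show "continuous_on (interior (path_image g)) h"
      using h homeomorphism_cont2 continuous_on_subset interior_subset by metis
    show "inj_on h (interior (path_image g))"
      using h by (metis homeomorphism_def inj_on_inverseI interior_subset subsetD)
  qed (use ne in auto)
  then show False by simp
qed

text \<open>The path may be closed, so it is halved into two arcs.\<close>

lemma interior_simple_path_image_empty:
  fixes g :: "real \<Rightarrow> complex"
  assumes "simple_path g"
  shows "interior (path_image g) = {}"
proof -
  have "arc (subpath 0 (1/2) g)" "arc (subpath (1/2) 1 g)"
    using assms by (auto intro!: arc_simple_path_subpath_interior)
  then have "interior (path_image (subpath 0 (1/2) g) \<union> path_image (subpath (1/2) 1 g)) = {}"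
    by (simp add: interior_closed_Un_empty_interior interior_arc_image_empty closed_arc_image)
  moreover have "path_image g = path_image (subpath 0 (1/2) g) \<union> path_image (subpath (1/2) 1 g)"
  proof -
    have "{0..1} = {0..1/2} \<union> {1/2..1::real}" by auto
    then show ?thesis unfolding path_image_subpath by (simp add: path_image_def image_Un)
  qed
  ultimately show ?thesis by simp
qed

lemma interior_closed_UN_empty:
  fixes f :: "'i \<Rightarrow> 'a::topological_space set"
  assumes "finite I" "\<And>i. i \<in> I \<Longrightarrow> closed (f i)" "\<And>i. i \<in> I \<Longrightarrow> interior (f i) = {}"
  shows "interior (\<Union>i\<in>I. f i) = {}"
  using assms
proof (induction I rule: finite_induct)
  case (insert i I)
  then have "interior (f i \<union> (\<Union>i\<in>I. f i)) = interior (f i)"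
    by (intro interior_closed_Un_empty_interior) auto
  then show ?case using insert by simp
qed simp

lemma connected_subset_component:
  assumes "f \<in> components S" "connected C" "C \<subseteq> S" "C \<inter> f \<noteq> {}"
  shows "C \<subseteq> f"
  using assms components_maximal by blast

text \<open>Janiszewski's theorem removes the compact arc \<open>g ` {d..s}\<close>, which is attached to the rest only
  at \<open>g d\<close>.\<close>

lemma frontier_component_spreads_right:
  fixes g :: "real \<Rightarrow> complex"
  assumes g: "simple_path g" and Y: "closed Y" and disj: "path_image g \<inter> Y \<subseteq> {pathstart g, pathfinish g}"
    and ends: "pathstart g \<in> Y" "pathfinish g \<in> Y"
    and f: "f \<in> components (- (Y \<union> path_image g))"
    and ab: "0 < a" "a < b" "b < 1" and ga: "g a \<in> frontier f"
  shows "g b \<in> frontier f"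
proof (rule ccontr)
  let ?X = "Y \<union> path_image g"
  assume nb: "g b \<notin> frontier f"
  have contg: "continuous_on {0..1} g" using simple_path_imp_path[OF g] by (simp add: path_def)
  have inj: "x = y \<or> x = 0 \<and> y = 1 \<or> x = 1 \<and> y = 0" if "x \<in> {0..1}" "y \<in> {0..1}" "g x = g y" for x y
    using g that by (auto simp: simple_path_def loop_free_def)
  have gY: "g x \<notin> Y" if "0 < x" "x < 1" for x
  proof
    assume "g x \<in> Y"
    moreover have "g x \<in> path_image g" using that by (simp add: path_image_def)
    ultimately have "g x = g 0 \<or> g x = g 1"
      using disj by (auto simp: pathstart_def pathfinish_def)
    then show False using inj[of x 0] inj[of x 1] that by auto
  qed
  have X: "closed ?X" using Y g closed_simple_path_image by blast
  have fX: "f \<subseteq> - ?X" using f in_components_subset by blast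
  have gbf: "g b \<notin> closure f"
    using nb fX ab by (auto simp: frontier_def path_image_def dest!: interior_subset[THEN subsetD])
  define N where "N = - closure f"
  have "open N" "g b \<in> N" using gbf by (auto simp: N_def)
  moreover have "isCont g b"
    using contg ab by (intro continuous_on_interior[of "{0..1}"]) auto
  ultimately obtain e where e: "0 < e" "\<And>x. \<bar>x - b\<bar> < e \<Longrightarrow> g x \<in> N"
    by (metis continuous_at_open open_dist dist_real_def)
  \<comment> \<open>The order is \<open>0 < d < a < s < b\<close>. The term \<open>b - e / 2\<close>
    in the maximum keeps the stretch of \<open>g\<close> from \<open>s\<close> to \<open>b\<close>
    within the open set \<open>N\<close>, which misses the closure of \<open>f\<close>; the midpoint
    only ensures \<open>a < s\<close>.\<close>
  define d s where "d = a / 2" and "s = max ((a + b) / 2) (b - e / 2)"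
  have ds: "0 < d" "d < a" "a < s" "s < b" "b - s < e" using ab e(1) by (auto simp: d_def s_def max_def field_simps)
  \<comment> \<open>The stretch of \<open>g\<close> strictly between \<open>s\<close> and
    \<open>b\<close> is left out of both sets. It is the only gap through which a connected set
    avoiding \<open>K\<close> and \<open>Z\<close> can cross the boundary of
    \<open>f\<close>.\<close>
  define K Z where "K = g ` {d..s}" and "Z = Y \<union> g ` {0..d} \<union> g ` {b..1}"
  have contsub: "continuous_on {u..v} g" if "0 \<le> u" "v \<le> 1" for u v
    using contg by (rule continuous_on_subset) (use that in auto)
  have arcK: "arc (subpath d s g)" "path_image (subpath d s g) = K"
    using g ab ds by (auto intro!: arc_simple_path_subpath_interior simp: path_image_subpath K_def)
  have Z: "closed Z"
    unfolding Z_def using Y ab ds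
    by (intro closed_Un compact_imp_closed[OF compact_continuous_image] contsub) auto
  have KZ: "K \<inter> Z = {g d}"
  proof -
    have "x = d" if x: "x \<in> {d..s}" "g x \<in> Z" for x
    proof -
      have "g x \<notin> Y" using gY[of x] x(1) ds ab by auto
      then obtain v where "v \<in> {0..d} \<union> {b..1}" "g x = g v" using x(2) unfolding Z_def by blast
      then show ?thesis using inj[of x v] x(1) ds ab by auto
    qed
    moreover have "g d \<in> K" "g d \<in> Z" using ds by (auto simp: K_def Z_def)
    ultimately show ?thesis unfolding K_def by blast
  qed
  have notZ: "g x \<notin> Z" if "a \<le> x" "x \<le> s" for x
    using that KZ inj[of x d] ds ab by (force simp: K_def)
  obtain ra where ra: "0 < ra" "ball (g a) ra \<subseteq> - Z"
    using Z notZ[of a] ds by (metis ComplI less_imp_le open_Compl open_contains_ball order_refl)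
  have "g s \<in> N" using e(2)[of s] ds by auto
  then obtain rs where rs: "0 < rs" "ball (g s) rs \<subseteq> - Z \<inter> N"
    using Z notZ[of s] ds \<open>open N\<close>
    by (metis (no_types, lifting) ComplI IntI less_imp_le open_Compl open_Int open_contains_ball order_refl)
  obtain x where x: "x \<in> f" "x \<in> ball (g a) ra"
    using ga ra(1) by (auto simp: frontier_def closure_approachable dist_commute)
  have "interior K = {}" using interior_arc_image_empty[OF arcK(1)] arcK(2) by simp
  then obtain y where y: "y \<in> ball (g s) rs" "y \<notin> K"
    using rs(1) interior_maximal[of "ball (g s) rs" K] by fastforce
  \<comment> \<open>The point \<open>x\<close> of \<open>f\<close> is close to \<open>g a\<close>
    and \<open>y\<close> is close to \<open>g s\<close> but outside the closure of \<open>f\<close>.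
    They are joined off the arc \<open>K\<close>, and off \<open>Z\<close> by running along
    \<open>g\<close> itself from \<open>a\<close> to \<open>s\<close>; the sets \<open>K\<close> and
    \<open>Z\<close> share one point, which is connected.\<close>
  have "connected_component (- (K \<union> Z)) x y"
  proof (rule Janiszewski)
    show "compact K" using arcK compact_arc_image by metis
    have "K \<subseteq> path_image g" using ds ab by (auto simp: K_def path_image_def)
    then have "x \<in> - K" using x fX by auto
    moreover have "connected (- K)" using connected_arc_complement[OF arcK(1)] arcK(2) by simp
    ultimately show "connected_component (- K) x y"
      using y by (auto simp: connected_iff_connected_component)
    let ?C = "ball (g a) ra \<union> g ` {a..s} \<union> ball (g s) rs"
    have "g a \<in> ball (g a) ra \<inter> g ` {a..s}" "g s \<in> (ball (g a) ra \<union> g ` {a..s}) \<inter> ball (g s) rs"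
      using ds ra rs by auto
    then have ne: "ball (g a) ra \<inter> g ` {a..s} \<noteq> {}" "(ball (g a) ra \<union> g ` {a..s}) \<inter> ball (g s) rs \<noteq> {}"
      by blast+
    have "connected (g ` {a..s})" using ds ab by (intro connected_continuous_image contsub) auto
    then have "connected ?C" by (intro connected_Un connected_ball ne)
    moreover have "?C \<subseteq> - Z" using ra rs notZ by auto
    ultimately show "connected_component (- Z) x y"
      using x y unfolding connected_component_def by blast
  qed (use Z KZ in auto)
  then obtain C where C: "connected C" "C \<subseteq> - (K \<union> Z)" "x \<in> C" "y \<in> C"
    by (auto simp: connected_component_def)
  have "y \<notin> f" using y rs closure_subset by (fastforce simp: N_def)
  \<comment> \<open>The connected set has to cross the frontier of \<open>f\<close>, and it can do
    so only on the gap, where \<open>g\<close> stays in \<open>N\<close> and thus away from that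
    frontier.\<close>
  then obtain c where c: "c \<in> C" "c \<in> frontier f"
    using connected_Int_frontier[OF C(1), of f] C x by blast
  then have "c \<in> Y \<union> path_image g"
    using frontier_of_components_closed_complement[OF X f] by blast
  moreover have cKZ: "c \<notin> K \<union> Z" using c(1) C(2) by blast
  ultimately obtain u where u: "u \<in> {0..1}" "c = g u" unfolding Z_def path_image_def by blast
  moreover have "u \<notin> {0..d}" "u \<notin> {d..s}" "u \<notin> {b..1}" using cKZ u(2) unfolding K_def Z_def by blast+
  ultimately have u: "c = g u" "s < u" "u < b" by auto
  then have "c \<in> N" using e(2)[of u] ds by auto
  then show False using c(2) by (auto simp: N_def frontier_def)
qed

text \<open>Parameters smaller than the given one are reached by reversing the path, the two
  endpoints by closedness of the frontier.\<close>

lemma frontier_component_spreads: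
  fixes g :: "real \<Rightarrow> complex"
  assumes g: "simple_path g" and Y: "closed Y" and disj: "path_image g \<inter> Y \<subseteq> {pathstart g, pathfinish g}"
    and ends: "pathstart g \<in> Y" "pathfinish g \<in> Y"
    and f: "f \<in> components (- (Y \<union> path_image g))"
    and x: "x \<in> path_image g" "x \<notin> Y" "x \<in> frontier f"
  shows "path_image g \<subseteq> frontier f"
proof -
  obtain a where a: "x = g a" "0 \<le> a" "a \<le> 1" using x by (auto simp: path_image_def)
  moreover have "a \<noteq> 0" "a \<noteq> 1" using x a ends by (auto simp: pathstart_def pathfinish_def)
  ultimately have a: "x = g a" "0 < a" "a < 1" by auto
  have "g b \<in> frontier f" if "0 < b" "b < 1" for b
  proof -
    consider "a = b" | "a < b" | "b < a" by linarith
    then show ?thesis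
    proof cases
      case 2
      then show ?thesis using frontier_component_spreads_right[OF g Y disj ends f, of a b] a x that by simp
    next
      case 3
      have "simple_path (reversepath g)" "path_image (reversepath g) \<inter> Y \<subseteq> {pathstart (reversepath g), pathfinish (reversepath g)}"
        "pathstart (reversepath g) \<in> Y" "pathfinish (reversepath g) \<in> Y"
        "f \<in> components (- (Y \<union> path_image (reversepath g)))"
        using g disj ends f by (auto simp: simple_path_reversepath)
      from frontier_component_spreads_right[OF this(1) Y this(2-5), of "1 - a" "1 - b"]
      have "reversepath g (1 - b) \<in> frontier f" using 3 a x that by (simp add: reversepath_def)
      then show ?thesis by (simp add: reversepath_def)
    qed (use a x in auto)
  qed
  then have "g ` {0<..<1} \<subseteq> frontier f" by auto
  then have "closure (g ` {0<..<1}) \<subseteq> frontier f" by (simp add: closure_minimal)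
  moreover have "path_image g \<subseteq> closure (g ` {0<..<1})"
  proof -
    have "continuous_on (closure {0<..<1}) g" using simple_path_imp_path[OF g] by (simp add: path_def)
    then have "g ` closure {0<..<1} \<subseteq> closure (g ` {0<..<1})"
      by (intro image_closure_subset) (auto simp: closure_subset)
    then show ?thesis by (simp add: path_image_def)
  qed
  ultimately show ?thesis by blast
qed

section \<open>Crosscuts of a disc, the two sides of an arc, and separation\<close>

lemma inside_sphere: "inside (sphere z r) = ball z r" for z :: complex
proof -
  have "inside (frontier (cball z r)) = interior (cball z r)"
    by (intro inside_frontier_eq_interior) auto
  then show ?thesis by simp
qed

text \<open>Circle and crosscut form a theta curve. The pieces are the insides of the two Jordan
  curves made of the crosscut and one of the circular arcs between its endpoints.\<close>

lemma crosscut_components: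
  fixes n :: "real \<Rightarrow> complex"
  assumes n: "arc n" and r: "0 < r"
    and ends: "pathstart n \<in> sphere z r" "pathfinish n \<in> sphere z r"
    and mid: "path_image n - {pathstart n, pathfinish n} \<subseteq> ball z r"
  obtains U V where "ball z r - path_image n = U \<union> V" "connected U" "connected V"
proof -
  let ?c = "circlepath z r" and ?a = "pathstart n" and ?b = "pathfinish n"
  have ne: "?a \<noteq> ?b" using n arc_distinct_ends by metis
  obtain u d where ud: "arc u" "arc d" "pathstart u = ?a" "pathfinish u = ?b"
     "pathstart d = ?b" "pathfinish d = ?a"
     "path_image u \<inter> path_image d = {?a, ?b}" "path_image u \<union> path_image d = path_image ?c"
    using exists_double_arc[of ?c ?a ?b] r ends ne by (auto simp: simple_path_circlepath)
  then have sph: "path_image u \<union> path_image d = sphere z r" using r by simp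
  \<comment> \<open>The reversal makes the three arcs of the theta curve share their start and their
    finish.\<close>
  define d' where "d' = reversepath d"
  have d': "arc d'" "pathstart d' = ?a" "pathfinish d' = ?b" "path_image d' = path_image d"
    using ud by (auto simp: d'_def arc_reversepath)
  have sep: "path_image n \<inter> sphere z r = {?a, ?b}"
    using ends mid by (auto simp: pathstart_in_path_image pathfinish_in_path_image)
  have int: "path_image u \<inter> path_image d' = {?a, ?b}"
    "path_image u \<inter> path_image n = {?a, ?b}" "path_image d' \<inter> path_image n = {?a, ?b}"
    using sep ud sph d' by auto
  have ball: "inside (path_image u \<union> path_image d') = ball z r"
    using sph d' by (simp add: inside_sphere)
  have "path_image n - {?a, ?b} \<noteq> {}" using n nonempty_simple_path_endless arc_imp_simple_path by blast
  then have "path_image n \<inter> inside (path_image u \<union> path_image d') \<noteq> {}"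
    using mid ball by blast
  then have split: "inside (path_image u \<union> path_image n) \<union> inside (path_image d' \<union> path_image n) \<union>
           (path_image n - {?a, ?b}) = ball z r"
    using split_inside_simple_closed_curve[of u ?a ?b d' n] int n ud d' ne ball arc_imp_simple_path by metis
  have conn: "connected (inside (path_image w \<union> path_image n))"
    if "arc w" "pathstart w = ?a" "pathfinish w = ?b" "path_image w \<inter> path_image n = {?a, ?b}" for w
  proof -
    have "simple_path (w +++ reversepath n)"
      using that n by (auto simp: simple_path_join_loop_eq arc_reversepath)
    then have "connected (inside (path_image (w +++ reversepath n)))"
      using Jordan_inside_outside that by auto
    then show ?thesis using that by (simp add: path_image_join)
  qed
  have "inside (path_image w \<union> path_image n) \<inter> path_image n = {}" for w
    using inside_no_overlap[of "path_image w \<union> path_image n"] by blast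
  then have "ball z r - path_image n = inside (path_image u \<union> path_image n) \<union> inside (path_image d' \<union> path_image n)"
    using split sep by auto
  then show thesis using that conn int ud d' by blast
qed

text \<open>Applied to the distance from the midpoint of a curve, this cuts out the stretch around
  the midpoint that remains in a disc, however often the curve returns to the disc elsewhere. The
  time is the maximum of a compact superlevel set, and the intermediate value theorem forces
  equality there.\<close>

lemma last_exit_time:
  fixes \<phi> :: "real \<Rightarrow> real"
  assumes cont: "continuous_on {0..h} \<phi>" and h: "0 \<le> h" and r: "r \<le> \<phi> 0" "\<phi> h < r"
  obtains s where "0 \<le> s" "s < h" "\<phi> s = r" "\<And>t. s < t \<Longrightarrow> t \<le> h \<Longrightarrow> \<phi> t < r"
proof -
  let ?S = "{t \<in> {0..h}. r \<le> \<phi> t}"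
  have "closed ?S"
    using continuous_closed_preimage[OF cont, of "{r..}"] by (simp add: vimage_def Int_def)
  then have "compact ?S"
    using closed_Int_compact[of ?S "{0..h}"] by (simp add: Int_def conj_commute conj_left_commute)
  then obtain s where s: "s \<in> ?S" "\<And>t. t \<in> ?S \<Longrightarrow> t \<le> s"
    using compact_attains_sup[of ?S] h r by force
  obtain t where t: "s \<le> t" "t \<le> h" "\<phi> t = r"
    using IVT2'[of \<phi> h r s] s(1) r continuous_on_subset[OF cont, of "{s..h}"] by auto
  then have "t = s" using s(1) s(2)[of t] r by auto
  show thesis
  proof (rule that[of s])
    show "\<phi> s = r" using t \<open>t = s\<close> by simp
    then show "s < h" using s(1) r(2) by (cases "s = h") auto
    show "\<phi> t < r" if "s < t" "t \<le> h" for t using s(1) s(2)[of t] that by force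
  qed (use s in auto)
qed

text \<open>The part of \<open>g\<close> around its midpoint \<open>p\<close> is a crosscut of a
  small disc and leaves at most two pieces. The rest of \<open>g\<close> may re-enter the disc, so a
  piece need not lie in one component; but points very close to \<open>p\<close> in the same piece
  do, by Janiszewski's theorem. Three components approaching \<open>p\<close> then yield three such
  points for two pieces.\<close>

lemma at_most_two_sides:
  fixes g :: "real \<Rightarrow> complex"
  assumes g: "simple_path g" and Y: "closed Y" and disj: "path_image g \<inter> Y \<subseteq> {pathstart g, pathfinish g}"
    and ends: "pathstart g \<in> Y" "pathfinish g \<in> Y"
    and f: "\<And>i. i \<in> {0, 1, 2::nat} \<Longrightarrow> f i \<in> components (- (Y \<union> path_image g))"
    and fr: "\<And>i. i \<in> {0, 1, 2} \<Longrightarrow> path_image g \<subseteq> frontier (f i)"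
  shows "f 0 = f 1 \<or> f 0 = f 2 \<or> f 1 = f 2"
proof -
  have contg: "continuous_on {0..1} g" using simple_path_imp_path[OF g] by (simp add: path_def)
  have inj: "x = y \<or> x = 0 \<and> y = 1 \<or> x = 1 \<and> y = 0" if "x \<in> {0..1}" "y \<in> {0..1}" "g x = g y" for x y
    using g that by (auto simp: simple_path_def loop_free_def)
  have g01: "g 0 \<in> Y" "g 1 \<in> Y" using ends by (auto simp: pathstart_def pathfinish_def)
  define p where "p = g (1/2)"
  have pg: "p \<in> path_image g" by (auto simp: p_def path_image_def)
  have "p \<noteq> g 0" "p \<noteq> g 1" using inj[of "1/2" 0] inj[of "1/2" 1] by (auto simp: p_def)
  then have "p \<notin> Y" using disj pg by (auto simp: pathstart_def pathfinish_def)
  then obtain r where r: "0 < r" "cball p r \<subseteq> - Y"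
    using Y by (metis ComplI open_Compl open_contains_cball)
  have far: "r < dist p y" if "y \<in> Y" for y using r that by force
  have cont: "continuous_on {0..1/2} (\<lambda>t. dist p (g t))" "continuous_on {0..1/2} (\<lambda>t. dist p (g (1 - t)))"
    by (intro continuous_intros continuous_on_subset[OF contg] continuous_on_compose2[OF contg]; force)+
  obtain s where s: "0 \<le> s" "s < 1/2" "dist p (g s) = r" "\<And>t. s < t \<Longrightarrow> t \<le> 1/2 \<Longrightarrow> dist p (g t) < r"
    using last_exit_time[OF cont(1), of r] far[OF g01(1)] r by (auto simp: p_def)
  obtain t' where t': "0 \<le> t'" "t' < 1/2" "dist p (g (1 - t')) = r"
    "\<And>t. t' < t \<Longrightarrow> t \<le> 1/2 \<Longrightarrow> dist p (g (1 - t)) < r"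
    using last_exit_time[OF cont(2), of r] far[OF g01(2)] r by (auto simp: p_def)
  define t where "t = 1 - t'"
  have t: "1/2 < t" "t \<le> 1" "dist p (g t) = r" using t' by (auto simp: t_def)
  have inside: "dist p (g u) < r" if "s < u" "u < t" for u
    using s(4)[of u] t'(4)[of "1 - u"] that by (cases "u \<le> 1/2") (auto simp: t_def)
  \<comment> \<open>With \<open>s\<close> positive the parameters differ by less than 1, so the
    subpath is an arc even if \<open>g\<close> is closed.\<close>
  have "s \<noteq> 0" using s far g01 by force
  then have st: "0 < s" "s < t" "\<bar>s - t\<bar> < 1" using s t by auto
  define n where "n = subpath s t g"
  have n: "arc n" "pathstart n = g s" "pathfinish n = g t" "path_image n = g ` {s..t}"
    using g st t by (auto simp: n_def path_image_subpath intro: arc_simple_path_subpath_interior)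
  have n_sub: "path_image n \<subseteq> cball p r"
    using inside s t st unfolding n by (force simp: le_less)
  have "path_image n - {pathstart n, pathfinish n} \<subseteq> ball p r"
    using inside st unfolding n by (force simp: le_less)
  then obtain U V where UV: "ball p r - path_image n = U \<union> V" "connected U" "connected V"
    using crosscut_components[of n r p] n s t r by auto
  \<comment> \<open>The remainder of \<open>g\<close>. It meets the crosscut only on the circle and
    misses \<open>p\<close>, so a smaller ball of radius \<rho> avoids it.\<close>
  define K where "K = g ` {0..s} \<union> g ` {t..1}"
  have K: "closed K"
    unfolding K_def using st t
    by (intro closed_Un compact_imp_closed[OF compact_continuous_image] continuous_on_subset[OF contg]) auto
  have nK: "path_image n \<inter> K \<subseteq> sphere p r"
  proof -
    have "g u \<in> sphere p r" if u: "u \<in> {s..t}" "g u \<in> K" for u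
    proof -
      from u(2) obtain v where "v \<in> {0..s} \<union> {t..1}" "g u = g v" unfolding K_def by blast
      then have "u = s \<or> u = t" using inj[of u v] u(1) st t by auto
      then show ?thesis using s t by auto
    qed
    then show ?thesis by (auto simp: n)
  qed
  have gK: "path_image g = path_image n \<union> K"
  proof -
    have "{0..1} = {s..t} \<union> ({0..s} \<union> {t..1})" using st t by auto
    then show ?thesis unfolding path_image_def[of g] n K_def by (simp only: image_Un)
  qed
  have "p \<notin> K"
  proof
    assume "p \<in> K"
    then obtain v where v: "v \<in> {0..s} \<union> {t..1}" "g (1/2) = g v" unfolding K_def p_def by blast
    then show False using inj[of "1/2" v] st t s by auto
  qed
  then obtain \<rho> where \<rho>: "0 < \<rho>" "ball p \<rho> \<subseteq> - K \<inter> ball p r"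
    using K r by (metis ComplI IntI centre_in_ball open_Compl open_Int open_ball open_contains_ball)
  have "\<exists>x. x \<in> f i \<and> x \<in> ball p \<rho>" if "i \<in> {0, 1, 2}" for i
    using fr[OF that] pg \<rho>(1) by (fastforce simp: frontier_def closure_approachable dist_commute)
  then obtain x where x: "\<And>i. i \<in> {0, 1, 2} \<Longrightarrow> x i \<in> f i \<and> x i \<in> ball p \<rho>" by metis
  have xX: "x i \<notin> Y \<union> path_image g" if "i \<in> {0, 1, 2}" for i
    using x[OF that] f[OF that] in_components_subset by blast
  then have xUV: "x i \<in> U \<union> V" if "i \<in> {0, 1, 2}" for i
    using x[OF that] xX[OF that] \<rho> UV(1) gK that by blast
  have same: "f i = f j"
    if ij: "i \<in> {0, 1, 2}" "j \<in> {0, 1, 2}" and W: "x i \<in> W" "x j \<in> W" "connected W" "W \<subseteq> ball p r - path_image n" for i j W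
  proof -
    \<comment> \<open>The circle is added to both closed sets so that their intersection is exactly
      the circle, which is connected. The first set is avoided inside \<open>W\<close>, the second
      inside the small ball around \<open>p\<close>.\<close>
    have "connected_component (- ((sphere p r \<union> path_image n) \<union> (sphere p r \<union> Y \<union> K))) (x i) (x j)"
    proof (rule Janiszewski)
      show "compact (sphere p r \<union> path_image n)" using compact_arc_image[OF n(1)] by auto
      show "closed (sphere p r \<union> Y \<union> K)" using Y K by (intro closed_Un closed_sphere)
      have "(sphere p r \<union> path_image n) \<inter> (sphere p r \<union> Y \<union> K) = sphere p r"
        using nK n_sub r by auto
      then show "connected ((sphere p r \<union> path_image n) \<inter> (sphere p r \<union> Y \<union> K))"
        by (simp add: connected_sphere)
      have "W \<subseteq> - (sphere p r \<union> path_image n)" using W(4) by auto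
      then show "connected_component (- (sphere p r \<union> path_image n)) (x i) (x j)"
        using W unfolding connected_component_def by blast
      have "ball p \<rho> \<subseteq> - (sphere p r \<union> Y \<union> K)"
        using \<rho> r ball_subset_cball[of p r] by fastforce
      then show "connected_component (- (sphere p r \<union> Y \<union> K)) (x i) (x j)"
        using x[OF ij(1)] x[OF ij(2)] connected_ball unfolding connected_component_def by blast
    qed
    then obtain C where C: "connected C" "C \<subseteq> - ((sphere p r \<union> path_image n) \<union> (sphere p r \<union> Y \<union> K))"
        "x i \<in> C" "x j \<in> C"
      by (auto simp: connected_component_def)
    then have "C \<subseteq> - (Y \<union> path_image g)" using gK by auto
    then have "C \<subseteq> f i" using connected_subset_component[OF f[OF ij(1)] C(1)] C x[OF ij(1)] by blast
    then show "f i = f j"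
      using C x[OF ij(2)] f[OF ij(1)] f[OF ij(2)] components_nonoverlap by blast
  qed
  have sub: "U \<subseteq> ball p r - path_image n" "V \<subseteq> ball p r - path_image n" using UV by auto
  have "x 0 \<in> U \<union> V" "x 1 \<in> U \<union> V" "x 2 \<in> U \<union> V" using xUV by auto
  then show ?thesis
    using same[of 0 1 U] same[of 0 1 V] same[of 0 2 U] same[of 0 2 V] same[of 1 2 U] same[of 1 2 V] sub UV
    by auto
qed

text \<open>The first half of \<open>g\<close> together with \<open>Y\<close> and the second half of
  \<open>g\<close> are both connected and meet in the two points \<open>g (1/2)\<close> and
  \<open>g 1\<close>. A connected complement of their union would make this intersection connected,
  by the dual form of Janiszewski's theorem.\<close>

lemma simple_path_separates:
  fixes g :: "real \<Rightarrow> complex"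
  assumes g: "simple_path g" and Y: "compact Y" "connected Y"
    and disj: "path_image g \<inter> Y \<subseteq> {pathstart g, pathfinish g}"
    and ends: "pathstart g \<in> Y" "pathfinish g \<in> Y"
  shows "\<not> connected (- (Y \<union> path_image g))"
proof
  let ?g1 = "subpath 0 (1/2) g" and ?g2 = "subpath (1/2) 1 g"
  have g01: "g 0 \<in> Y" "g 1 \<in> Y" using ends by (auto simp: pathstart_def pathfinish_def)
  have inj: "x = y \<or> x = 0 \<and> y = 1 \<or> x = 1 \<and> y = 0" if "x \<in> {0..1}" "y \<in> {0..1}" "g x = g y" for x y
    using g that by (auto simp: simple_path_def loop_free_def)
  have path: "path ?g1" "path ?g2" using simple_path_imp_path[OF g] by auto
  have im: "path_image ?g1 = g ` {0..1/2}" "path_image ?g2 = g ` {1/2..1}" by (auto simp: path_image_subpath)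
  have "{0..1} = {0..1/2} \<union> {1/2..1::real}" by auto
  then have g_eq: "path_image g = path_image ?g1 \<union> path_image ?g2"
    unfolding im by (simp add: path_image_def image_Un)
  assume "connected (- (Y \<union> path_image g))"
  then have "connected (- ((Y \<union> path_image ?g1) \<union> path_image ?g2))" by (simp only: g_eq Un_assoc)
  moreover have "connected (Y \<union> path_image ?g1)"
  proof (rule connected_Un)
    have "g 0 \<in> path_image ?g1" unfolding im by auto
    then show "Y \<inter> path_image ?g1 \<noteq> {}" using g01 by blast
  qed (use Y path in \<open>auto intro: connected_path_image\<close>)
  ultimately have "connected ((Y \<union> path_image ?g1) \<inter> path_image ?g2)"
    using path Y by (intro Janiszewski_dual compact_Un compact_path_image connected_path_image)
  moreover have "(Y \<union> path_image ?g1) \<inter> path_image ?g2 = {g (1/2), g 1}"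
  proof -
    have mid: "g u = g (1/2) \<or> g u = g 1" if u: "u \<in> {1/2..1}" "g u \<in> Y \<union> g ` {0..1/2}" for u
    proof (cases "g u \<in> Y")
      case True
      moreover have "g u \<in> path_image g" using u(1) by (simp add: path_image_def)
      ultimately have "g u = g 0 \<or> g u = g 1"
        using disj by (auto simp: pathstart_def pathfinish_def)
      then show ?thesis using inj[of u 0] u by auto
    next
      case False
      then obtain v where "v \<in> {0..1/2}" "g u = g v" using u by auto
      then have "u = 1/2 \<or> u = 1" using inj[of u v] u(1) by auto
      then show ?thesis by metis
    qed
    have "(Y \<union> g ` {0..1/2}) \<inter> g ` {1/2..1} \<subseteq> {g (1/2), g 1}"
    proof
      fix x assume x: "x \<in> (Y \<union> g ` {0..1/2}) \<inter> g ` {1/2..1}"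
      then obtain u where "u \<in> {1/2..1}" "x = g u" by blast
      then show "x \<in> {g (1/2), g 1}" using mid[of u] x by simp
    qed
    moreover have "g (1/2) \<in> g ` {0..1/2}" "g (1/2) \<in> g ` {1/2..1}" "g 1 \<in> g ` {1/2..1}" by auto
    ultimately show ?thesis unfolding im using g01 by blast
  qed
  moreover have "g (1/2) \<noteq> g 1" using inj[of "1/2" 1] by auto
  ultimately show False
    by (metis connected_finite_iff_sing finite.emptyI finite.insertI insert_not_empty insertI1 insertI2 singletonD)
qed

text \<open>Maps from a contractible set to the circle are nullhomotopic, which is Borsuk's
  criterion for not separating the plane.\<close>

lemma contractible_connected_complement:
  fixes S :: "complex set"
  assumes "compact S" "contractible S"
  shows "connected (- S)"
  using Borsuk_separation_theorem[OF assms(1)] nullhomotopic_from_contractible[OF _ _ assms(2)]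
  by (metis DIM_complex order_refl)

lemma AR_arc_image:
  fixes g :: "real \<Rightarrow> complex"
  assumes "arc g"
  shows "AR (path_image g)"
  using homeomorphic_arc_image_interval[OF assms, of 0 1] homeomorphic_AR_iff_AR convex_imp_AR[of "{0..1::real}"]
  by auto

section \<open>Plane graphs and their duals\<close>

text \<open>All vertices are kept whatever \<open>A\<close> is, so connectedness of the skeleton
  means that \<open>A\<close> spans the graph.\<close>

definition skeleton :: "'e plane_digraph \<Rightarrow> 'e set \<Rightarrow> complex set" where
  "skeleton G A = verts G \<union> (\<Union>e\<in>A. path_image (curve G e))"

definition ends :: "'e plane_digraph \<Rightarrow> 'e \<Rightarrow> complex set" where
  "ends G e = {pathstart (curve G e), pathfinish (curve G e)}"

definition open_edge :: "'e plane_digraph \<Rightarrow> 'e \<Rightarrow> complex set" where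
  "open_edge G e = path_image (curve G e) - verts G"

text \<open>These are the ends of the dual edge of \<open>e\<close>; a singleton is a dual
  loop.\<close>

definition sides :: "'e plane_digraph \<Rightarrow> 'e \<Rightarrow> complex set set" where
  "sides G e = {f \<in> faces G. edge_bounds G e f}"

lemma skeleton_mono: "A \<subseteq> A' \<Longrightarrow> skeleton G A \<subseteq> skeleton G A'"
  by (auto simp: skeleton_def)

lemma skeleton_insert: "skeleton G (insert e A) = skeleton G A \<union> path_image (curve G e)"
  by (auto simp: skeleton_def)

lemma faces_eq: "faces G = components (- skeleton G (edges G))"
  by (simp add: faces_def skeleton_def)

lemma Un_UN_disjointI:
  assumes "P \<inter> P' = {}" "\<And>i. i \<in> I \<Longrightarrow> P' \<inter> f i = {}" "\<And>j. j \<in> J \<Longrightarrow> P \<inter> f j = {}"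
    and "\<And>i j. i \<in> I \<Longrightarrow> j \<in> J \<Longrightarrow> f i \<inter> f j = {}"
  shows "(P \<union> (\<Union>i\<in>I. f i)) \<inter> (P' \<union> (\<Union>j\<in>J. f j)) = {}"
  using assms by blast

locale plane_graph =
  fixes G :: "'e plane_digraph"
  assumes fin_emb: "finite_embedded G"
begin

lemma finite_verts: "finite (verts G)" and finite_edges: "finite (edges G)"
  using fin_emb by (auto simp: finite_embedded_def)

context
  fixes e assumes e: "e \<in> edges G"
begin

lemma simple: "simple_path (curve G e)"
  and image_Int_verts: "path_image (curve G e) \<inter> verts G = ends G e"
  using fin_emb e by (auto simp: finite_embedded_def ends_def)

lemma ends_subset: "ends G e \<subseteq> verts G" and ends_image: "ends G e \<subseteq> path_image (curve G e)"
  using image_Int_verts by auto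

lemma open_edge_eq: "open_edge G e = path_image (curve G e) - ends G e"
  using image_Int_verts by (auto simp: open_edge_def)

lemma image_eq: "path_image (curve G e) = open_edge G e \<union> ends G e"
  using open_edge_eq ends_image by auto

lemma connected_open_edge: "connected (open_edge G e)"
  using connected_simple_path_endless[OF simple] by (simp add: open_edge_eq ends_def)

lemma open_edge_nonempty: "open_edge G e \<noteq> {}"
  using nonempty_simple_path_endless[OF simple] by (simp add: open_edge_eq ends_def)

lemma image_subset_closure: "path_image (curve G e) \<subseteq> closure (open_edge G e)"
proof -
  have "curve G e ` closure {0<..<1} \<subseteq> closure (curve G e ` {0<..<1})"
    using simple_path_imp_path[OF simple]
    by (intro image_closure_subset) (auto simp: path_def closure_subset)
  then show ?thesis
    using simple_path_endless[OF simple] by (simp add: open_edge_eq ends_def path_image_def)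
qed

lemma open_edge_disjoint_skeleton:
  assumes "A \<subseteq> edges G" "e \<notin> A"
  shows "open_edge G e \<inter> skeleton G A = {}"
proof -
  have "path_image (curve G e) \<inter> path_image (curve G d) \<subseteq> verts G" if "d \<in> A" for d
  proof -
    have "\<forall>e\<in>edges G. \<forall>d\<in>edges G. e \<noteq> d \<longrightarrow> path_image (curve G e) \<inter> path_image (curve G d) \<subseteq> verts G"
      using fin_emb by (simp add: finite_embedded_def)
    moreover have "d \<in> edges G" "e \<noteq> d" using that assms by auto
    ultimately show ?thesis using e by simp
  qed
  then show ?thesis by (auto simp: open_edge_def skeleton_def)
qed

lemma image_Int_skeleton:
  assumes "A \<subseteq> edges G" "e \<notin> A"
  shows "path_image (curve G e) \<inter> skeleton G A = ends G e"
proof -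
  have "ends G e \<subseteq> skeleton G A" using ends_subset by (auto simp: skeleton_def)
  then show ?thesis using open_edge_disjoint_skeleton[OF assms] image_eq by blast
qed

end

lemma compact_skeleton:
  assumes "A \<subseteq> edges G"
  shows "compact (skeleton G A)"
proof -
  have "finite A" using assms finite_edges finite_subset by blast
  then show ?thesis unfolding skeleton_def
    using finite_verts assms simple
    by (intro compact_Un compact_UN finite_imp_compact compact_simple_path_image) auto
qed

lemma closed_skeleton: "A \<subseteq> edges G \<Longrightarrow> closed (skeleton G A)"
  by (simp add: compact_imp_closed compact_skeleton)

text \<open>This makes the faces dense: every nonempty open set of the plane contains a point of
  some face.\<close>

lemma interior_skeleton: "interior (skeleton G (edges G)) = {}"
proof -
  have "interior (\<Union>e\<in>edges G. path_image (curve G e)) = {}"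
    using finite_edges simple
    by (intro interior_closed_UN_empty) (auto simp: interior_simple_path_image_empty closed_simple_path_image)
  then show ?thesis
    unfolding skeleton_def
    using finite_verts by (simp add: interior_closed_Un_empty_interior finite_imp_closed)
      (use finite_imp_not_open interior_subset open_interior finite_subset in metis)
qed

lemma faceD:
  assumes "f \<in> faces G"
  shows "open f" "connected f" "f \<noteq> {}" "f \<subseteq> - skeleton G (edges G)"
    "frontier f \<subseteq> skeleton G (edges G)"
  using assms closed_skeleton[OF order_refl] unfolding faces_eq
  by (auto simp: open_Compl in_components_connected in_components_nonempty
      intro: open_components[of "- skeleton G (edges G)"]
      dest: in_components_subset frontier_of_components_closed_complement)

lemma faces_disjoint: "f \<in> faces G \<Longrightarrow> h \<in> faces G \<Longrightarrow> f \<noteq> h \<Longrightarrow> f \<inter> h = {}"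
  unfolding faces_eq using components_nonoverlap by blast

lemma in_faceE:
  assumes "x \<notin> skeleton G (edges G)"
  obtains f where "f \<in> faces G" "x \<in> f"
  using assms Union_components[of "- skeleton G (edges G)"] unfolding faces_eq by blast

lemma face_subset_iff:
  assumes "f \<in> faces G" "A \<subseteq> edges G" "U \<in> components (- skeleton G A)"
  shows "f \<subseteq> U \<longleftrightarrow> f \<inter> U \<noteq> {}"
  using assms connected_subset_component[of U "- skeleton G A" f] faceD[of f] skeleton_mono[of A "edges G" G]
  by blast

lemma sides_subset: "sides G e \<subseteq> faces G"
  by (auto simp: sides_def)

section \<open>Faces along an edge, and connectedness of a drawing against cuts\<close>

lemma frontier_meets_edge:
  assumes "e \<in> edges G" "f \<in> faces G" "x \<in> open_edge G e" "x \<in> frontier f"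
  shows "f \<in> sides G e"
proof -
  let ?Y = "skeleton G (edges G - {e})"
  have X: "skeleton G (edges G) = ?Y \<union> path_image (curve G e)"
    using assms(1) by (metis insert_Diff skeleton_insert)
  have "path_image (curve G e) \<subseteq> frontier f"
  proof (rule frontier_component_spreads)
    show "closed ?Y" by (rule closed_skeleton) auto
    have "path_image (curve G e) \<inter> ?Y = ends G e" using assms(1) by (intro image_Int_skeleton) auto
    then show "path_image (curve G e) \<inter> ?Y \<subseteq> {pathstart (curve G e), pathfinish (curve G e)}"
      "pathstart (curve G e) \<in> ?Y" "pathfinish (curve G e) \<in> ?Y" by (auto simp: ends_def)
    show "f \<in> components (- (?Y \<union> path_image (curve G e)))" using assms(2) X by (simp add: faces_eq)
    show "x \<in> path_image (curve G e)" "x \<notin> ?Y" "x \<in> frontier f"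
      using assms open_edge_disjoint_skeleton[of e "edges G - {e}"] by (auto simp: open_edge_def)
  qed (use assms simple in auto)
  then show ?thesis using assms by (simp add: sides_def edge_bounds_def)
qed

text \<open>A face that meets a ball around \<open>p\<close> does not contain \<open>p\<close>, so
  the ball meets its frontier. If the ball avoids all vertices and other edges, this happens on
  \<open>e\<close>, and the face then has \<open>e\<close> on its boundary.\<close>

lemma edge_neighbourhood:
  assumes "e \<in> edges G" "p \<in> open_edge G e"
  obtains r where "0 < r" "ball p r \<inter> skeleton G (edges G) \<subseteq> open_edge G e"
    "\<And>f. f \<in> faces G \<Longrightarrow> f \<inter> ball p r \<noteq> {} \<Longrightarrow> f \<in> sides G e"
proof -
  let ?Y = "skeleton G (edges G - {e})"
  have "p \<notin> ?Y" "closed ?Y" using assms open_edge_disjoint_skeleton[of e "edges G - {e}"] closed_skeleton by auto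
  then obtain r where r: "0 < r" "ball p r \<subseteq> - ?Y" by (metis ComplI open_Compl open_contains_ball)
  have X: "skeleton G (edges G) = ?Y \<union> path_image (curve G e)"
    using assms(1) by (metis insert_Diff skeleton_insert)
  have sub: "ball p r \<inter> skeleton G (edges G) \<subseteq> open_edge G e"
    using r X by (auto simp: open_edge_def skeleton_def)
  show thesis
  proof (rule that[OF r(1) sub])
    fix f assume f: "f \<in> faces G" "f \<inter> ball p r \<noteq> {}"
    have "p \<notin> f" using assms faceD(4)[OF f(1)] X by (auto simp: open_edge_def)
    then have "ball p r \<inter> frontier f \<noteq> {}"
      using f r centre_in_ball[of p r] by (intro connected_Int_frontier connected_ball) blast+
    then obtain x where x: "x \<in> ball p r" "x \<in> frontier f" by blast
    then have "x \<in> open_edge G e" using sub faceD(5)[OF f(1)] by blast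
    then show "f \<in> sides G e" using frontier_meets_edge assms f x by blast
  qed
qed

lemma side_exists:
  assumes "e \<in> edges G"
  shows "sides G e \<noteq> {}"
proof -
  obtain p where "p \<in> open_edge G e" using open_edge_nonempty assms by blast
  then obtain r where r: "0 < r" "\<And>f. f \<in> faces G \<Longrightarrow> f \<inter> ball p r \<noteq> {} \<Longrightarrow> f \<in> sides G e"
    using edge_neighbourhood assms by metis
  have "\<not> ball p r \<subseteq> skeleton G (edges G)"
    using r(1) interior_skeleton by (metis centre_in_ball empty_iff interior_maximal open_ball subsetD)
  then obtain x where "x \<in> ball p r" "x \<notin> skeleton G (edges G)" by blast
  then show ?thesis using in_faceE r(2) by blast
qed

lemma sides_pair:
  assumes e: "e \<in> edges G"
  shows "\<exists>f h. sides G e = {f, h}"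
proof -
  obtain f where f: "f \<in> sides G e" using side_exists e by blast
  have two: "a = b \<or> a = c \<or> b = c" if "a \<in> sides G e" "b \<in> sides G e" "c \<in> sides G e" for a b c
  proof -
    let ?Y = "skeleton G (edges G - {e})" and ?f = "\<lambda>i::nat. if i = 0 then a else if i = 1 then b else c"
    have X: "skeleton G (edges G) = ?Y \<union> path_image (curve G e)"
      using e by (metis insert_Diff skeleton_insert)
    have "?f 0 = ?f 1 \<or> ?f 0 = ?f 2 \<or> ?f 1 = ?f 2"
    proof (rule at_most_two_sides)
      show "simple_path (curve G e)" using simple e .
      show "closed ?Y" by (rule closed_skeleton) auto
      have "path_image (curve G e) \<inter> ?Y = ends G e" using e by (intro image_Int_skeleton) auto
      then show "path_image (curve G e) \<inter> ?Y \<subseteq> {pathstart (curve G e), pathfinish (curve G e)}"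
        "pathstart (curve G e) \<in> ?Y" "pathfinish (curve G e) \<in> ?Y" by (auto simp: ends_def)
      have *: "?f i \<in> sides G e" for i using that by simp
      show "?f i \<in> components (- (?Y \<union> path_image (curve G e)))" for i
        using *[of i] X by (simp add: sides_def faces_eq)
      show "path_image (curve G e) \<subseteq> frontier (?f i)" for i
        using *[of i] by (simp add: sides_def edge_bounds_def)
    qed
    then show ?thesis by simp
  qed
  show ?thesis
  proof (cases "sides G e = {f}")
    case False
    then obtain h where "h \<in> sides G e" "h \<noteq> f" using f by blast
    then have "sides G e = {f, h}" using two[of f h] f by blast
    then show ?thesis by blast
  qed blast
qed

lemma connected_face_Un_edge:
  assumes "e \<in> edges G" "f \<in> sides G e"
  shows "connected (f \<union> open_edge G e)"
proof (rule connected_intermediate_closure[of f])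
  show "connected f" using assms sides_subset faceD by blast
  show "f \<union> open_edge G e \<subseteq> closure f"
    using assms closure_subset by (auto simp: sides_def edge_bounds_def open_edge_def frontier_def)
qed auto

text \<open>Around a point of such an edge, a small ball consists of points of the edge and of faces
  having the edge as a side, and those faces all belong to \<open>S\<close>.\<close>

lemma open_face_union:
  assumes S: "S \<subseteq> faces G" and full: "\<And>e. e \<in> D \<Longrightarrow> sides G e \<inter> S \<noteq> {} \<Longrightarrow> sides G e \<subseteq> S" and D: "D \<subseteq> edges G"
  shows "open (\<Union>S \<union> (\<Union>e\<in>{e \<in> D. sides G e \<inter> S \<noteq> {}}. open_edge G e))" (is "open ?U")
proof (subst open_subopen, intro ballI)
  fix p assume "p \<in> ?U"
  then consider f where "f \<in> S" "p \<in> f" | e where "e \<in> D" "sides G e \<inter> S \<noteq> {}" "p \<in> open_edge G e" by blast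
  then show "\<exists>T. open T \<and> p \<in> T \<and> T \<subseteq> ?U"
  proof cases
    case 1
    then show ?thesis using faceD(1)[of f] S by (intro exI[of _ f]) blast
  next
    case 2
    obtain r where r: "0 < r" "ball p r \<inter> skeleton G (edges G) \<subseteq> open_edge G e"
      "\<And>f. f \<in> faces G \<Longrightarrow> f \<inter> ball p r \<noteq> {} \<Longrightarrow> f \<in> sides G e"
      using edge_neighbourhood 2 D by (metis subsetD)
    have "ball p r \<subseteq> ?U"
    proof
      fix x assume x: "x \<in> ball p r"
      show "x \<in> ?U"
      proof (cases "x \<in> skeleton G (edges G)")
        case True
        then show ?thesis using r(2) 2 x by blast
      next
        case False
        then obtain f where "f \<in> faces G" "x \<in> f" using in_faceE by blast
        then show ?thesis using r(3)[of f] full[OF 2(1,2)] x by blast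
      qed
    qed
    then show ?thesis using r(1) by (intro exI[of _ "ball p r"]) auto
  qed
qed

text \<open>For an uncrossed cut of the faces, the faces on either side together with the remaining
  open edges between them would be two disjoint open sets covering the complement.\<close>

lemma connected_complement_imp_cut_connected:
  assumes A: "A \<subseteq> edges G" and conn: "connected (- skeleton G A)"
  shows "cut_connected (faces G) (edges G - A) (sides G)"
  unfolding cut_connected_def
proof (intro allI impI, rule ccontr)
  fix S assume S: "S \<subseteq> faces G" "S \<noteq> {}" "S \<noteq> faces G"
    and "\<not> (\<exists>e\<in>edges G - A. \<exists>x\<in>sides G e \<inter> S. \<exists>y\<in>sides G e. y \<notin> S)"
  then have no_cross: "sides G e \<subseteq> S" if "e \<in> edges G - A" "sides G e \<inter> S \<noteq> {}" for e
    using that by blast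
  let ?S' = "faces G - S" and ?D = "edges G - A"
  let ?U = "\<lambda>S. \<Union>S \<union> (\<Union>e\<in>{e \<in> ?D. sides G e \<inter> S \<noteq> {}}. open_edge G e)"
  have no_cross': "sides G e \<subseteq> ?S'" if "e \<in> ?D" "sides G e \<inter> ?S' \<noteq> {}" for e
    using no_cross[of e] that sides_subset[of e] by blast
  have opn: "open (?U S)" "open (?U ?S')"
    by (rule open_face_union; use S no_cross no_cross' in blast)+
  have face_edge: "f \<inter> open_edge G e = {}" if "f \<in> faces G" "e \<in> ?D" for f e
    using that faceD(4)[of f] by (auto simp: open_edge_def skeleton_def)
  have edge_edge: "open_edge G d \<inter> open_edge G e = {}" if "d \<in> ?D" "e \<in> ?D" "d \<noteq> e" for d e
    using open_edge_disjoint_skeleton[of d "{e}"] that by (auto simp: open_edge_def skeleton_def)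
  have disj: "?U S \<inter> ?U ?S' = {}"
  proof (rule Un_UN_disjointI)
    show "\<Union>S \<inter> \<Union>?S' = {}" using faces_disjoint S by blast
    fix d assume "d \<in> {e \<in> ?D. sides G e \<inter> S \<noteq> {}}"
    then have d: "d \<in> ?D" "sides G d \<subseteq> S" using no_cross by auto
    then show "\<Union>?S' \<inter> open_edge G d = {}" using face_edge by fast
    fix e assume "e \<in> {e \<in> ?D. sides G e \<inter> ?S' \<noteq> {}}"
    then have "e \<in> ?D" "d \<noteq> e" using d by auto
    then show "open_edge G d \<inter> open_edge G e = {}" using edge_edge d by blast
  next
    fix d assume "d \<in> {e \<in> ?D. sides G e \<inter> ?S' \<noteq> {}}"
    then show "\<Union>S \<inter> open_edge G d = {}" using face_edge S by fast
  qed
  have cover: "- skeleton G A \<subseteq> ?U S \<union> ?U ?S'"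
  proof
    fix x assume x: "x \<in> - skeleton G A"
    show "x \<in> ?U S \<union> ?U ?S'"
    proof (cases "x \<in> skeleton G (edges G)")
      case False
      then obtain f where "f \<in> faces G" "x \<in> f" using in_faceE by blast
      then show ?thesis by (cases "f \<in> S") auto
    next
      case True
      then obtain e where e: "e \<in> ?D" "x \<in> open_edge G e"
        using x by (auto simp: skeleton_def open_edge_def)
      then have "sides G e \<inter> S \<noteq> {} \<or> sides G e \<inter> ?S' \<noteq> {}"
        using side_exists[of e] sides_subset[of e] by blast
      then show ?thesis using e by blast
    qed
  qed
  have meets: "?U T \<inter> - skeleton G A \<noteq> {}" if T: "T \<subseteq> faces G" "T \<noteq> {}" for T
  proof -
    obtain f where f: "f \<in> T" using T by blast
    then have "f \<noteq> {}" "f \<subseteq> - skeleton G A"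
      using faceD[of f] T skeleton_mono[OF A, of G] by blast+
    then show ?thesis using f by blast
  qed
  show False
    using connectedD[OF conn opn] disj cover meets[of S] meets[of ?S'] S by blast
qed

text \<open>Every component of the complement contains a face, so the faces inside one component
  \<open>U\<close> form a proper cut. A crossing edge outside \<open>A\<close> contradicts this:
  glued to either of its sides it is connected and avoids the skeleton of \<open>A\<close>, so both
  sides lie in \<open>U\<close>.\<close>

lemma cut_connected_imp_connected_complement:
  assumes A: "A \<subseteq> edges G" and conn: "cut_connected (faces G) (edges G - A) (sides G)"
  shows "connected (- skeleton G A)"
proof (rule ccontr)
  assume not: "\<not> connected (- skeleton G A)"
  let ?C = "components (- skeleton G A)"
  have dense: "\<exists>f\<in>faces G. f \<subseteq> U" if "U \<in> ?C" for U
  proof -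
    have "open U" "U \<noteq> {}"
      using that open_components[of "- skeleton G A" U] closed_skeleton[OF A] in_components_nonempty
      by (auto simp: open_Compl)
    then have "\<not> U \<subseteq> skeleton G (edges G)" using interior_skeleton interior_maximal by blast
    then obtain x f where "x \<in> U" "f \<in> faces G" "x \<in> f" using in_faceE by blast
    then show ?thesis using face_subset_iff[OF _ A that] by blast
  qed
  obtain x where "x \<in> - skeleton G A" using not by (metis connected_empty ex_in_conv)
  then have "x \<in> \<Union>?C" using Union_components by metis
  then obtain U where U: "U \<in> ?C" by blast
  moreover have "U \<noteq> - skeleton G A" using U in_components_connected not by blast
  moreover have "U \<subseteq> - skeleton G A" using U in_components_subset by blast
  ultimately obtain y where y: "y \<in> - skeleton G A" "y \<notin> U" by blast
  then have "y \<in> \<Union>?C" using Union_components by metis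
  then obtain U' where U': "U' \<in> ?C" "y \<in> U'" by blast
  then have "U' \<inter> U = {}" using components_nonoverlap[OF U'(1) U] y(2) by auto
  note U' = U'(1) this
  let ?S = "{f \<in> faces G. f \<subseteq> U}"
  have "?S \<noteq> {}" using dense U by blast
  moreover have "?S \<noteq> faces G"
  proof -
    obtain h where h: "h \<in> faces G" "h \<subseteq> U'" using dense[OF U'(1)] by blast
    then have "\<not> h \<subseteq> U" using U'(2) faceD(3)[OF h(1)] by blast
    then show ?thesis using h(1) by blast
  qed
  ultimately obtain e f h where e: "e \<in> edges G - A" "f \<in> sides G e" "h \<in> sides G e" "f \<in> ?S" "h \<notin> ?S"
    using cut_connectedD[OF conn, of ?S] by (metis (no_types, lifting) mem_Collect_eq subsetI)
  have sub: "k \<union> open_edge G e \<subseteq> - skeleton G A" if "k \<in> sides G e" for k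
    using faceD(4)[of k] that sides_subset[of e] skeleton_mono[OF A, of G]
      open_edge_disjoint_skeleton[of e A] e(1) A by blast
  have "f \<noteq> {}" using e(4) faceD(3) by blast
  then have "f \<union> open_edge G e \<subseteq> U"
    using connected_subset_component[OF U connected_face_Un_edge[of e f] sub[OF e(2)]] e by blast
  moreover have "open_edge G e \<noteq> {}" using open_edge_nonempty e by blast
  ultimately have "h \<union> open_edge G e \<subseteq> U"
    using connected_subset_component[OF U connected_face_Un_edge[of e h] sub[OF e(3)]] e by blast
  then show False using e sides_subset[of e] by blast
qed

text \<open>An uncrossed cut of the vertices would divide the skeleton into two disjoint closed
  sets; finiteness of the graph makes them closed.\<close>

lemma connected_skeleton_imp_cut_connected:
  assumes A: "A \<subseteq> edges G" and conn: "connected (skeleton G A)"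
  shows "cut_connected (verts G) A (ends G)"
  unfolding cut_connected_def
proof (intro allI impI, rule ccontr)
  fix S assume S: "S \<subseteq> verts G" "S \<noteq> {}" "S \<noteq> verts G"
    and "\<not> (\<exists>e\<in>A. \<exists>x\<in>ends G e \<inter> S. \<exists>y\<in>ends G e. y \<notin> S)"
  then have no_cross: "ends G e \<subseteq> S" if "e \<in> A" "ends G e \<inter> S \<noteq> {}" for e
    using that by blast
  let ?Y = "\<lambda>S. S \<union> (\<Union>e\<in>{e \<in> A. ends G e \<subseteq> S}. path_image (curve G e))"
  let ?S' = "verts G - S"
  have fin: "finite {e \<in> A. P e}" for P using A finite_edges finite_subset by fastforce
  have clo: "closed (?Y T)" if "T \<subseteq> verts G" for T
  proof (intro closed_Un closed_UN fin ballI)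
    show "closed T" using that finite_verts finite_imp_closed finite_subset by blast
  qed (use A simple closed_simple_path_image in blast)
  have cover: "skeleton G A \<subseteq> ?Y S \<union> ?Y ?S'"
  proof -
    have "ends G e \<subseteq> S \<or> ends G e \<subseteq> ?S'" if "e \<in> A" for e
      using no_cross[OF that] ends_subset[of e] that A by blast
    then show ?thesis unfolding skeleton_def by blast
  qed
  have edge_vert: "path_image (curve G e) \<inter> T = {}" if "e \<in> A" "ends G e \<inter> T = {}" "T \<subseteq> verts G" for e T
    using image_Int_verts[of e] that A by blast
  have edge_edge: "path_image (curve G d) \<inter> path_image (curve G e) \<subseteq> ends G d \<inter> ends G e" if "d \<in> A" "e \<in> A" "d \<noteq> e" for d e
    using image_Int_skeleton[of d "{e}"] image_Int_skeleton[of e "{d}"] that A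
    unfolding skeleton_def by blast
  have "?Y S \<inter> ?Y ?S' = {}"
  proof (rule Un_UN_disjointI)
    fix d assume "d \<in> {e \<in> A. ends G e \<subseteq> S}"
    then have d: "d \<in> A" "ends G d \<subseteq> S" by auto
    show "?S' \<inter> path_image (curve G d) = {}"
      using edge_vert[of d ?S'] d by (simp add: Int_commute) blast
    fix e assume "e \<in> {e \<in> A. ends G e \<subseteq> ?S'}"
    then have e: "e \<in> A" "ends G e \<subseteq> ?S'" by auto
    then have "ends G d \<inter> ends G e = {}" using d by blast
    moreover have "d \<noteq> e" using e(2) d(2) by (auto simp: ends_def)
    ultimately show "path_image (curve G d) \<inter> path_image (curve G e) = {}"
      using edge_edge[OF d(1) e(1)] by blast
  next
    fix e assume "e \<in> {e \<in> A. ends G e \<subseteq> ?S'}"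
    then have "e \<in> A" "ends G e \<inter> S = {}" by auto
    then show "S \<inter> path_image (curve G e) = {}" using edge_vert[of e S] S by (simp add: Int_commute)
  qed blast
  then have disj: "?Y S \<inter> ?Y ?S' \<inter> skeleton G A = {}" by blast
  have "closed (?Y S)" "closed (?Y ?S')" using clo S by blast+
  from connected_closedD[OF conn disj cover this] show False
    using S unfolding skeleton_def by blast
qed

end

section \<open>Contractible trees, dual trees and Euler's formula\<close>

context plane_graph
begin

lemma ends_pair: "\<exists>x y. ends G e = {x, y}"
  by (auto simp: ends_def)

text \<open>Absolute retracts are used because they can be glued: two closed ones meeting in an
  absolute retract have an absolute retract as union. A largest parent-closed vertex set with this
  property is stable under adding an edge towards the root, so induction along \<open>rooted\<close>
  shows that it contains all vertices.\<close>

lemma contractible_tree: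
  assumes A: "A \<subseteq> edges G" and conn: "cut_connected (verts G) A (ends G)" and r: "r \<in> verts G"
    and p: "p ` (verts G - {r}) = A" "\<And>n. n \<in> verts G - {r} \<Longrightarrow> n \<in> ends G (p n)"
  shows "contractible (skeleton G A)"
proof -
  interpret T: out_edges "verts G" A "ends G" r p
    using assms ends_subset ends_pair by unfold_locales blast+
  let ?Y = "\<lambda>S. S \<union> (\<Union>n\<in>S - {r}. path_image (curve G (p n)))"
  let ?P = "\<lambda>S. S \<subseteq> verts G \<and> r \<in> S \<and> (\<forall>n\<in>S - {r}. ends G (p n) \<subseteq> S) \<and> AR (?Y S)"
  have bound: "\<forall>S. ?P S \<longrightarrow> card S < Suc (card (verts G))"
    using finite_verts by (auto simp: less_Suc_eq_le card_mono)
  have "?P {r}" using r by (simp add: AR_singleton)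
  then obtain S where S: "?P S" and max: "\<And>S'. ?P S' \<Longrightarrow> card S' \<le> card S"
    using ex_has_greatest_nat[of ?P "{r}" card "Suc (card (verts G))"] bound by (metis less_imp_le)
  have "verts G \<subseteq> S"
  proof
    fix x assume "x \<in> verts G"
    then have "x \<in> rooted (verts G) r (ends G) p" using T.rooted_eq by simp
    then show "x \<in> S"
    proof induction
      case root
      then show ?case using S by blast
    next
      case (step n m)
      show ?case
      proof (rule ccontr)
        assume n: "n \<notin> S"
        let ?e = "p n"
        have e: "?e \<in> A" "?e \<in> edges G" using p step A by auto
        have eq: "?Y (insert n S) = ?Y S \<union> path_image (curve G ?e)"
        proof -
          have "insert n S - {r} = insert n (S - {r})" using step by auto
          moreover have "n \<in> path_image (curve G ?e)" using ends_image[OF e(2)] step by auto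
          ultimately show ?thesis by auto
        qed
        \<comment> \<open>Distinct edges meet only in common ends, and the ends of the edges already
          present lie in \<open>S\<close>. As \<open>n\<close> is new, the parent \<open>m\<close>
          is the only point shared.\<close>
        have int: "?Y S \<inter> path_image (curve G ?e) = {m}"
        proof
          have "m \<in> path_image (curve G ?e)" using ends_image[OF e(2)] step by auto
          then show "{m} \<subseteq> ?Y S \<inter> path_image (curve G ?e)" using step by auto
          show "?Y S \<inter> path_image (curve G ?e) \<subseteq> {m}"
          proof
            fix x assume x: "x \<in> ?Y S \<inter> path_image (curve G ?e)"
            have "x \<in> S"
            proof (cases "x \<in> S")
              case False
              then obtain k where k: "k \<in> S - {r}" "x \<in> path_image (curve G (p k))" using x by blast
              have k': "p k \<in> A" "k \<in> verts G - {r}" "k \<noteq> n" using k S p n by blast+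
              then have "p k \<noteq> p n" using T.inj_out step(1) by (metis inj_onD)
              then have "x \<in> ends G (p k)"
                using image_Int_skeleton[of "p k" "{p n}"] k k' x e A by (auto simp: skeleton_def)
              then show ?thesis using S k by blast
            qed
            moreover have "x \<in> ends G ?e" using image_Int_verts[OF e(2)] x S calculation by blast
            ultimately show "x \<in> {m}" using step n by auto
          qed
        qed
        have arc: "arc (curve G ?e)"
          using simple[OF e(2)] step by (auto simp: ends_def doubleton_eq_iff intro: simple_path_imp_arc)
        have "finite S" using S finite_verts finite_subset by blast
        have "closed (?Y S)"
        proof (intro closed_Un closed_UN ballI)
          show "closed S" "finite (S - {r})" using \<open>finite S\<close> finite_imp_closed by auto
          fix k assume "k \<in> S - {r}"
          then have "p k \<in> edges G" using S p A by blast
          then show "closed (path_image (curve G (p k)))" using simple closed_simple_path_image by blast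
        qed
        moreover have "AR (?Y S \<inter> path_image (curve G ?e))" unfolding int by (rule AR_singleton)
        ultimately have "AR (?Y (insert n S))"
          unfolding eq using S arc by (meson AR_closed_Un AR_arc_image closed_arc_image)
        moreover have "\<forall>k\<in>insert n S - {r}. ends G (p k) \<subseteq> insert n S" using S step by auto
        ultimately have "?P (insert n S)" using S step by blast
        then have "card (insert n S) \<le> card S" by (rule max)
        then show False using n \<open>finite S\<close> by simp
      qed
    qed
  qed
  then have "S = verts G" using S by blast
  then have "AR (?Y (verts G))" using S by simp
  moreover have "?Y (verts G) = skeleton G A" using p(1) unfolding skeleton_def by blast
  ultimately show ?thesis using AR_imp_contractible by metis
qed

text \<open>Connectivity of the dual edges is exported as well, since it is what
  \<open>out_edges\<close> requires to show that no other \<open>q\<close> exists.\<close>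

lemma dual_tree:
  assumes A: "A \<subseteq> edges G" and con: "contractible (skeleton G A)" and f: "f \<in> faces G"
  obtains q where "bij_betw q (faces G - {f}) (edges G - A)"
    "\<And>h. h \<in> faces G - {f} \<Longrightarrow> h \<in> sides G (q h)"
    "cut_connected (faces G) (edges G - A) (sides G)"
proof -
  have conn: "connected (skeleton G A)" using con by (rule contractible_imp_connected)
  have "connected (- skeleton G A)"
    using contractible_connected_complement con compact_skeleton A by blast
  then have dual: "cut_connected (faces G) (edges G - A) (sides G)"
    using connected_complement_imp_cut_connected A by blast
  \<comment> \<open>Deleting \<open>e\<close> from the dual amounts to adding its curve to the
    skeleton of \<open>A\<close>; that skeleton is connected and contains both ends of the curve, so
    the plane becomes separated.\<close>
  have minimal: "\<not> cut_connected (faces G) (edges G - A - {e}) (sides G)" if e: "e \<in> edges G - A" for e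
  proof
    assume "cut_connected (faces G) (edges G - A - {e}) (sides G)"
    moreover have "edges G - A - {e} = edges G - insert e A" by auto
    ultimately have "connected (- skeleton G (insert e A))"
      using cut_connected_imp_connected_complement[of "insert e A"] A e by auto
    moreover have "\<not> connected (- (skeleton G A \<union> path_image (curve G e)))"
      using image_Int_skeleton[of e A] e A conn simple[of e] compact_skeleton[OF A]
      by (intro simple_path_separates) (auto simp: ends_def)
    ultimately show False by (simp add: skeleton_insert)
  qed
  have B: "sides G e \<subseteq> faces G" "\<exists>a b. sides G e = {a, b}" if "e \<in> edges G - A" for e
    using that sides_subset sides_pair by auto
  show thesis
    by (rule minimal_cut_connected_matching[OF dual f B minimal])
      (assumption | rule that[OF _ _ dual] | blast)+
qed

lemma faces_nonempty: "faces G \<noteq> {}"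
proof -
  have "skeleton G (edges G) \<noteq> UNIV" using interior_skeleton by auto
  then have "- skeleton G (edges G) \<noteq> {}" by blast
  then show ?thesis unfolding faces_eq by (simp only: components_eq_empty not_False_eq_True)
qed

text \<open>A spanning tree \<open>A\<close> has one edge for each vertex but one, and the dual tree
  on the other edges has one for each face but one. The second bijection also bounds the number of
  faces.\<close>

theorem Euler_formula:
  assumes "cut_connected (verts G) (edges G) (ends G)" "verts G \<noteq> {}"
  shows "finite (faces G)" "card (verts G) + card (faces G) = card (edges G) + 2"
proof -
  obtain r where r: "r \<in> verts G" using assms(2) by blast
  obtain A where A: "A \<subseteq> edges G" "cut_connected (verts G) A (ends G)"
    "\<And>e. e \<in> A \<Longrightarrow> \<not> cut_connected (verts G) (A - {e}) (ends G)"
    using minimal_cut_connected[OF finite_edges assms(1)] by metis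
  obtain p where p: "bij_betw p (verts G - {r}) A" "\<And>n. n \<in> verts G - {r} \<Longrightarrow> n \<in> ends G (p n)"
    by (rule minimal_cut_connected_matching[OF A(2) r])
      (use A ends_subset ends_pair in blast)+
  then have con: "contractible (skeleton G A)"
    using contractible_tree[OF A(1,2) r, of p] by (auto simp: bij_betw_def)
  obtain f where f: "f \<in> faces G" using faces_nonempty by blast
  obtain q where q: "bij_betw q (faces G - {f}) (edges G - A)"
    using dual_tree[OF A(1) con f] by metis
  have "finite (faces G - {f})" using q bij_betw_finite finite_edges by blast
  then show fin: "finite (faces G)" by simp
  have "card (verts G - {r}) = card A" "card (faces G - {f}) = card (edges G - A)"
    using p(1) q bij_betw_same_card by blast+
  moreover have "card (edges G - A) = card (edges G) - card A" "card A \<le> card (edges G)"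
    using A(1) finite_edges by (auto simp: card_Diff_subset finite_subset card_mono)
  moreover have "card (verts G) > 0" "card (faces G) > 0"
    using r f fin finite_verts by (auto simp: card_gt_0_iff)
  ultimately show "card (verts G) + card (faces G) = card (edges G) + 2"
    using r f fin finite_verts by simp
qed

section \<open>From a matching to a spanning tree\<close>

lemma plane_subgraph:
  assumes "W \<subseteq> verts G" "D \<subseteq> edges G" "\<And>e. e \<in> D \<Longrightarrow> ends G e \<subseteq> W"
  shows "plane_graph (G\<lparr>verts := W, edges := D\<rparr>)"
proof
  have "path_image (curve G e) \<inter> W = ends G e" if "e \<in> D" for e
    using image_Int_verts[of e] assms that by blast
  moreover have "path_image (curve G e) \<inter> path_image (curve G d) \<subseteq> W" if "e \<in> D" "d \<in> D" "e \<noteq> d" for e d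
    using image_Int_skeleton[of e "{d}"] assms that unfolding skeleton_def by blast
  moreover have "finite W" "finite D" using assms finite_verts finite_edges finite_subset by blast+
  moreover have "simple_path (curve G e)" if "e \<in> D" for e using simple assms(2) that by blast
  ultimately show "finite_embedded (G\<lparr>verts := W, edges := D\<rparr>)"
    unfolding finite_embedded_def by (auto simp: ends_def)
qed

end

lemma ends_update [simp]: "ends (G\<lparr>verts := W, edges := D\<rparr>) = ends G"
  by (simp add: fun_eq_iff ends_def)

lemma skeleton_update: "skeleton (G\<lparr>verts := W, edges := D\<rparr>) A = W \<union> (\<Union>e\<in>A. path_image (curve G e))"
  by (simp add: skeleton_def)

context plane_graph
begin

text \<open>In this form the incidence of the root with the deleted face is used: the two form one
  connected set and so fall on the same side of any closed curve system avoiding both.\<close>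

lemma connected_face_insert:
  assumes "f \<in> faces G" "v \<in> frontier f"
  shows "connected (insert v f)"
  by (rule connected_intermediate_closure[of f])
    (use assms faceD(2) closure_subset[of f] in \<open>auto simp: frontier_def\<close>)

text \<open>A component of the chosen out-edges that avoids the root would carry as many edges as
  vertices and hence, by Euler's formula, separate the plane.  On the side away from the root
  the matched edges would be one fewer than the vertices and faces they have to serve.\<close>

theorem matching_imp_connected:
  assumes conn: "cut_connected (verts G) (edges G) (ends G)"
    and r: "r \<in> verts G" and f0: "f0 \<in> faces G" "r \<in> frontier f0"
    and A: "A \<subseteq> edges G"
    and p: "inj_on p (verts G - {r})" "p ` (verts G - {r}) = A" "\<And>n. n \<in> verts G - {r} \<Longrightarrow> n \<in> ends G (p n)"
    and q: "inj_on q (faces G - {f0})" "q ` (faces G - {f0}) \<subseteq> edges G - A"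
      "\<And>h. h \<in> faces G - {f0} \<Longrightarrow> h \<in> sides G (q h)"
  shows "cut_connected (verts G) A (ends G)"
proof (rule ccontr)
  define P where "P S \<longleftrightarrow> S \<subseteq> verts G \<and> S \<noteq> {} \<and> r \<notin> S \<and>
    (\<forall>e\<in>A. \<forall>x\<in>ends G e. \<forall>y\<in>ends G e. x \<in> S \<longrightarrow> y \<in> S)" for S
  assume not: "\<not> cut_connected (verts G) A (ends G)"
  have "ends G e \<subseteq> verts G" if "e \<in> A" for e using that A ends_subset by blast
  then obtain S where "S \<subseteq> verts G" "S \<noteq> {}" "r \<notin> S"
    "\<And>e x y. e \<in> A \<Longrightarrow> x \<in> ends G e \<Longrightarrow> y \<in> ends G e \<Longrightarrow> x \<in> S \<Longrightarrow> y \<in> S"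
    using not_cut_connectedE[OF not r] by metis
  then have "P S" unfolding P_def by blast
  \<comment> \<open>A smallest set that avoids the root and is not left by any chosen edge is a
    single component of the chosen edges.\<close>
  then obtain S where S: "P S" and min: "\<And>S'. P S' \<Longrightarrow> card S \<le> card S'"
    using ex_has_least_nat[of P _ card] by metis
  then have SV: "S \<subseteq> verts G" "S \<noteq> {}" "r \<notin> S" by (auto simp: P_def)
  have closedS: "ends G e \<subseteq> S" if "e \<in> A" "x \<in> ends G e" "x \<in> S" for e x
    using S that unfolding P_def by blast
  have finS: "finite S" using SV finite_verts finite_subset by blast
  define D where "D = {e \<in> A. ends G e \<subseteq> S}"
  have D: "D \<subseteq> A" "D \<subseteq> edges G" using A by (auto simp: D_def)
  let ?K = "G\<lparr>verts := S, edges := D\<rparr>"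
  interpret K: plane_graph ?K
    by (rule plane_subgraph) (use SV D D_def in auto)
  have Kconn: "cut_connected S D (ends G)"
    unfolding cut_connected_def
  proof (intro allI impI, rule ccontr)
    fix S' assume S': "S' \<subseteq> S" "S' \<noteq> {}" "S' \<noteq> S"
      and nc: "\<not> (\<exists>e\<in>D. \<exists>x\<in>ends G e \<inter> S'. \<exists>y\<in>ends G e. y \<notin> S')"
    have "y \<in> S'" if "e \<in> A" "x \<in> ends G e" "y \<in> ends G e" "x \<in> S'" for e x y
    proof -
      have "e \<in> D" using closedS[of e x] that S' by (auto simp: D_def)
      then show ?thesis using nc that by blast
    qed
    then have "P S'" using SV S' unfolding P_def by blast
    then have "card S \<le> card S'" by (rule min)
    moreover have "card S' < card S" using S' finS by (simp add: psubsetI psubset_card_mono)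
    ultimately show False by simp
  qed
  \<comment> \<open>No out-edge of \<open>S\<close> leaves \<open>S\<close>, and a chosen edge
    within \<open>S\<close> is the out-edge of a vertex of \<open>S\<close>. Lacking the root, the
    component therefore has as many edges as vertices.\<close>
  have "D = p ` S"
  proof
    show "p ` S \<subseteq> D"
    proof
      fix e assume "e \<in> p ` S"
      then obtain n where n: "n \<in> S" "e = p n" by blast
      then have "n \<in> verts G - {r}" using SV by blast
      then have "e \<in> A" "n \<in> ends G e" using p n by blast+
      then show "e \<in> D" using closedS n by (simp add: D_def)
    qed
    show "D \<subseteq> p ` S"
    proof
      fix e assume e: "e \<in> D"
      then obtain n where "n \<in> verts G - {r}" "e = p n" using p(2) D by blast
      moreover from this have "n \<in> S" using p(3)[of n] e by (auto simp: D_def)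
      ultimately show "e \<in> p ` S" by blast
    qed
  qed
  moreover have "inj_on p S" using p(1) SV by (auto intro: inj_on_subset)
  ultimately have "card D = card S" by (simp add: card_image)
  \<comment> \<open>Equal numbers of vertices and edges leave exactly two faces in Euler's formula.
    They are disjoint, so at least one of them misses the root and can serve as
    \<open>U\<close>.\<close>
  then have "card (faces ?K) = 2"
    using K.Euler_formula(2) Kconn SV by simp
  then obtain U1 U2 where U12: "U1 \<in> faces ?K" "U2 \<in> faces ?K" "U1 \<noteq> U2"
    by (metis card_2_iff insertI1 insertI2)
  then have "U1 \<inter> U2 = {}" by (rule K.faces_disjoint)
  then obtain U where U: "U \<in> faces ?K" "r \<notin> U" using U12 by blast
  define X where "X = S \<union> (\<Union>e\<in>D. path_image (curve G e))"
  have X: "skeleton ?K D = X" by (simp add: X_def skeleton_update)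
  have UX: "open U" "connected U" "U \<noteq> {}" "U \<inter> X = {}" "closure U \<subseteq> U \<union> X"
    and Ucomp: "U \<in> components (- X)"
    using K.faceD[OF U(1)] U(1) X closure_Un_frontier[of U] unfolding faces_eq by auto
  have XV: "X \<inter> verts G = S"
  proof -
    have "path_image (curve G e) \<inter> verts G \<subseteq> S" if "e \<in> D" for e
      using image_Int_verts[of e] that D by (auto simp: D_def)
    then show ?thesis using SV(1) unfolding X_def by blast
  qed
  have Xsk: "X \<subseteq> skeleton G D" "skeleton G D \<subseteq> skeleton G (edges G)"
    using SV skeleton_mono[OF D(2), of G] by (auto simp: X_def skeleton_def)
  have face_U: "f \<subseteq> U" if "f \<in> faces G" "f \<inter> U \<noteq> {}" for f
    using connected_subset_component[OF Ucomp faceD(2)[OF that(1)]] faceD(4)[OF that(1)] Xsk that by blast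
  \<comment> \<open>The root is not on the component, so the root and \<open>f0\<close> together lie
    in one face of the component, and this face is not \<open>U\<close>.\<close>
  have f0U: "f0 \<inter> U = {}"
  proof (rule ccontr)
    assume ne: "f0 \<inter> U \<noteq> {}"
    have "r \<notin> X" using XV SV r by blast
    then have "insert r f0 \<subseteq> - X" using faceD(4)[OF f0(1)] Xsk by blast
    then have "insert r f0 \<subseteq> U"
      using connected_subset_component[OF Ucomp connected_face_insert[OF f0]] ne by blast
    then show False using U by blast
  qed
  \<comment> \<open>The edges that survive when everything inside \<open>U\<close> is erased. An
    edge outside this set runs inside \<open>U\<close> and can end outside \<open>U\<close> only in
    vertices of \<open>S\<close>.\<close>
  define E' where "E' = {e \<in> edges G. path_image (curve G e) \<inter> U = {}}"
  have DE': "D \<subseteq> E'" using D UX(4) by (auto simp: E'_def X_def)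
  have open_X: "open_edge G e \<inter> X = {}" if "e \<in> edges G - D" for e
    using open_edge_disjoint_skeleton[of e D] that D Xsk by blast
  have open_U: "open_edge G e \<subseteq> U" if "e \<in> edges G" "e \<notin> D" "open_edge G e \<inter> U \<noteq> {}" for e
    using connected_subset_component[OF Ucomp connected_open_edge] open_X[of e] that by blast
  have in_U: "open_edge G e \<subseteq> U" "ends G e \<subseteq> U \<union> S" if e: "e \<in> edges G - E'" for e
  proof -
    have "path_image (curve G e) \<inter> U \<noteq> {}" using e by (auto simp: E'_def)
    then have "open_edge G e \<inter> U \<noteq> {}"
      using image_subset_closure[of e] e open_Int_closure_eq_empty[OF UX(1), of "open_edge G e"] by blast
    then show sub: "open_edge G e \<subseteq> U" using open_U e DE' by blast
    then have "ends G e \<subseteq> closure U"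
      using closure_mono[OF sub] image_subset_closure[of e] ends_image[of e] e by blast
    then show "ends G e \<subseteq> U \<union> S" using UX(5) XV ends_subset[of e] e by blast
  qed
  let ?G' = "G\<lparr>verts := verts G - U, edges := E'\<rparr>"
  have E'_ends: "ends G e \<subseteq> verts G - U" if "e \<in> E'" for e
    using that ends_subset[of e] ends_image[of e] by (auto simp: E'_def)
  interpret G': plane_graph ?G'
    by (rule plane_subgraph) (use E'_ends E'_def in auto)
  have SU: "S \<subseteq> verts G - U" using SV UX(4) by (auto simp: X_def)
  obtain s where s: "s \<in> S" using SV by blast
  \<comment> \<open>Erasing keeps the graph connected: an erased edge attaches only to
    \<open>S\<close>, and \<open>S\<close> is held together by \<open>D\<close>, none of which is
    erased. A cut avoiding \<open>s\<close> avoids all of \<open>S\<close>, hence is not crossed by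
    erased edges either.\<close>
  have G'conn: "cut_connected (verts G - U) E' (ends G)"
  proof (rule ccontr)
    assume not': "\<not> ?thesis"
    have "s \<in> verts G - U" using s SU by blast
    then obtain W where W: "W \<subseteq> verts G - U" "W \<noteq> {}" "s \<notin> W"
      "\<And>e x y. e \<in> E' \<Longrightarrow> x \<in> ends G e \<Longrightarrow> y \<in> ends G e \<Longrightarrow> x \<in> W \<Longrightarrow> y \<in> W"
      using not_cut_connectedE[OF not' _ E'_ends] by metis
    have WS: "W \<inter> S = {}"
    proof (rule ccontr)
      assume "W \<inter> S \<noteq> {}"
      moreover have "W \<inter> S \<noteq> S" using s W(3) by blast
      ultimately obtain e x y where "e \<in> D" "x \<in> ends G e" "y \<in> ends G e" "x \<in> W \<inter> S" "y \<notin> W \<inter> S"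
        using cut_connectedD[OF Kconn, of "W \<inter> S"] by (metis Int_lower2)
      moreover from this have "y \<in> S" by (auto simp: D_def)
      ultimately show False using W(4)[of e x y] DE' by blast
    qed
    have "W \<subseteq> verts G" "W \<noteq> verts G" using W s SV by blast+
    then obtain e x y where e: "e \<in> edges G" "x \<in> ends G e" "y \<in> ends G e" "x \<in> W" "y \<notin> W"
      using cut_connectedD[OF conn _ W(2)] by metis
    then have "e \<in> edges G - E'" using W(4) by blast
    then show False using in_U(2)[of e] e W(1) WS by blast
  qed
  let ?F = "{f \<in> faces G. f \<inter> U = {}}"
  \<comment> \<open>After erasing, \<open>U\<close> has become a single face and the faces of
    \<open>G\<close> off \<open>U\<close> are unchanged.\<close>
  have "components (- skeleton ?G' E') = insert U ?F"
  proof (rule components_open_unique)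
    show "pairwise disjnt (insert U ?F)"
      using faces_disjoint by (auto simp: pairwise_def disjnt_def Int_commute)
    show "open f \<and> connected f \<and> f \<noteq> {}" if "f \<in> insert U ?F" for f
      using that UX(1-3) faceD(1-3)[of f] by (elim insertE) blast+
    have "\<Union>(insert U ?F) \<subseteq> - skeleton ?G' E'"
    proof -
      have "skeleton ?G' E' \<subseteq> skeleton G (edges G)" "U \<inter> skeleton ?G' E' = {}"
        by (auto simp: E'_def skeleton_def)
      then show ?thesis using faceD(4) by blast
    qed
    moreover have "- skeleton ?G' E' \<subseteq> \<Union>(insert U ?F)"
    proof
      fix x assume x: "x \<in> - skeleton ?G' E'"
      show "x \<in> \<Union>(insert U ?F)"
      proof (cases "x \<in> U")
        case False
        have "x \<notin> skeleton G (edges G)"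
        proof
          assume "x \<in> skeleton G (edges G)"
          moreover have "x \<notin> verts G" using x False by (auto simp: skeleton_update)
          ultimately obtain e where e: "e \<in> edges G" "x \<in> open_edge G e"
            by (auto simp: skeleton_def open_edge_def)
          moreover have "e \<notin> E'" using x e by (auto simp: skeleton_update open_edge_def)
          ultimately show False using in_U(1)[of e] False by blast
        qed
        then obtain f where "f \<in> faces G" "x \<in> f" using in_faceE by blast
        then show ?thesis using face_U[of f] False by blast
      qed simp
    qed
    ultimately show "\<Union>(insert U ?F) = - skeleton ?G' E'" by (rule subset_antisym)
  qed
  then have faces': "faces ?G' = insert U ?F" by (simp add: faces_eq[of ?G'])
  have "verts G \<noteq> {}" using r by blast
  note Euler = Euler_formula[OF conn this]
  have "verts ?G' \<noteq> {}" using s SU by auto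
  with G'conn have Euler': "card (verts G - U) + card (faces ?G') = card E' + 2"
    using G'.Euler_formula(2) by simp
  have "U \<notin> ?F" using UX(3) by blast
  then have "card (faces ?G') = Suc (card ?F)" using Euler(1) by (simp add: faces')
  moreover have "card (verts G) = card (verts G \<inter> U) + card (verts G - U)"
    by (rule card_Int_Diff[OF finite_verts])
  moreover have "card (faces G) = card ?F + card {f \<in> faces G. f \<inter> U \<noteq> {}}"
    using card_Int_Diff[OF Euler(1), of "{f. f \<inter> U = {}}"]
    by (simp only: Int_def set_diff_eq mem_Collect_eq)
  moreover have "card (edges G) = card E' + card (edges G - E')"
    using card_Int_Diff[OF finite_edges, of E'] by (simp add: Int_absorb1 E'_def)
  \<comment> \<open>The difference of the two Euler formulas. The surplus of one comes from
    \<open>U\<close>, which is itself a face of the smaller graph.\<close>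
  ultimately have count: "card (verts G \<inter> U) + card {f \<in> faces G. f \<inter> U \<noteq> {}} = Suc (card (edges G - E'))"
    using Euler(2) Euler' by linarith
  have "p ` (verts G \<inter> U) \<subseteq> (edges G - E') \<inter> A"
  proof
    fix e assume "e \<in> p ` (verts G \<inter> U)"
    then obtain n where n: "n \<in> verts G - {r}" "n \<in> U" "e = p n" using U by blast
    then have "e \<in> A" "n \<in> path_image (curve G e)" using p ends_image[of e] A by blast+
    then show "e \<in> (edges G - E') \<inter> A" using n A by (auto simp: E'_def)
  qed
  \<comment> \<open>The edge matched to a face inside \<open>U\<close> lies in the closure of that
    face, hence in \<open>U\<close> or on the component. The latter is excluded because edges used
    by \<open>q\<close> are not in \<open>A\<close>.\<close>
  moreover have qU: "q ` {f \<in> faces G. f \<inter> U \<noteq> {}} \<subseteq> (edges G - E') - A"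
  proof
    fix e assume "e \<in> q ` {f \<in> faces G. f \<inter> U \<noteq> {}}"
    then obtain f where f: "f \<in> faces G - {f0}" "f \<inter> U \<noteq> {}" "e = q f" using f0U by blast
    then have e: "e \<in> edges G - A" "f \<in> sides G e" using q by blast+
    then have "path_image (curve G e) \<subseteq> closure f" by (auto simp: sides_def edge_bounds_def frontier_def)
    also have "\<dots> \<subseteq> U \<union> X" using UX(5) closure_mono[OF face_U] f by blast
    finally have "open_edge G e \<subseteq> U" using open_X[of e] e D by (auto simp: open_edge_def)
    then have "e \<notin> E'" using open_edge_nonempty[of e] e by (auto simp: E'_def open_edge_def)
    then show "e \<in> edges G - E' - A" using e by blast
  qed
  ultimately have "p ` (verts G \<inter> U) \<inter> q ` {f \<in> faces G. f \<inter> U \<noteq> {}} = {}"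
    "p ` (verts G \<inter> U) \<union> q ` {f \<in> faces G. f \<inter> U \<noteq> {}} \<subseteq> edges G - E'" by blast+
  \<comment> \<open>Neither the root nor \<open>f0\<close> lies in \<open>U\<close>, so all vertices
    and faces there are matched, injectively and to disjoint sets of erased edges: one edge is
    missing.\<close>
  then have "card (p ` (verts G \<inter> U)) + card (q ` {f \<in> faces G. f \<inter> U \<noteq> {}}) \<le> card (edges G - E')"
    using finite_verts finite_edges Euler(1) by (simp flip: card_Un_disjoint add: card_mono)
  moreover have "inj_on p (verts G \<inter> U)" "inj_on q {f \<in> faces G. f \<inter> U \<noteq> {}}"
    using p(1) q(1) U f0U by (auto elim!: inj_on_subset)
  ultimately show False using count by (simp add: card_image)
qed

end

section \<open>Temperley's bijection\<close>

lemma ends_eq_tails: "ends G e = {tail G e d, tail G e (\<not> d)}"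
  by (cases d) (auto simp: ends_def tail_def)

lemma tail_in_ends: "tail G e d \<in> ends G e"
  by (simp add: ends_eq_tails[of G e d])

lemma in_ends_iff: "v \<in> ends G e \<longleftrightarrow> (\<exists>d. v = tail G e d)"
  by (auto simp: ends_def tail_def ex_bool_eq)

lemma graph_connected_imp_cut_connected:
  assumes "graph_connected G"
  shows "cut_connected (verts G) (edges G) (ends G)"
  unfolding cut_connected_def
proof (intro allI impI, rule ccontr)
  fix S assume S: "S \<subseteq> verts G" "S \<noteq> {}" "S \<noteq> verts G"
    and nc: "\<not> (\<exists>e\<in>edges G. \<exists>x\<in>ends G e \<inter> S. \<exists>y\<in>ends G e. y \<notin> S)"
  obtain u w where uw: "u \<in> S" "w \<in> verts G" "w \<notin> S" using S by blast
  then have "(u, w) \<in> {(tail G e d, head G e d) | e d. e \<in> edges G}\<^sup>*"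
    using assms S unfolding graph_connected_def by blast
  then have "w \<in> S"
  proof induction
    case (step y z)
    then obtain e d where "e \<in> edges G" "y = tail G e d" "z = tail G e (\<not> d)"
      by (auto simp: head_def)
    then have "e \<in> edges G" "y \<in> ends G e" "z \<in> ends G e" by (auto simp: tail_in_ends)
    then show ?case using nc step.IH by blast
  qed (rule uw)
  then show False using uw by blast
qed

lemma vef_weight_face [simp]: "vef_weight G {FNode f, ENode e} = 1"
  by (simp add: vef_weight_def)

text \<open>Only one direction of a non-loop leaves a given end, so the maximum ranges over a single
  value. Tree edges are never loops, so this determines every vertex link that comes from a
  tree.\<close>

lemma vef_weight_vertex:
  assumes "tail G e d \<noteq> tail G e (\<not> d)"
  shows "vef_weight G {VNode (tail G e d), ENode e} = weight G e d"
proof -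
  have "d' = d" if "tail G e d' = tail G e d" for d'
    using assms that by (cases d; cases d') auto
  then have "{weight G e' d' | e' d'. ENode e' \<in> {VNode (tail G e d), ENode e} \<and>
      VNode (tail G e' d') \<in> {VNode (tail G e d), ENode e}} = {weight G e d}" by auto
  then show ?thesis by (simp add: vef_weight_def)
qed

text \<open>A matching is coded by its two partner functions; only their values on \<open>V\<close>
  and \<open>F\<close> enter.\<close>

definition matching_of :: "complex set \<Rightarrow> complex set set \<Rightarrow> (complex \<Rightarrow> 'e) \<Rightarrow> (complex set \<Rightarrow> 'e) \<Rightarrow> 'e node set set" where
  "matching_of V F p q = (\<lambda>v. {VNode v, ENode (p v)}) ` V \<union> (\<lambda>f. {FNode f, ENode (q f)}) ` F"

lemma link_eq_iff [simp]:
  "{VNode v, ENode e} = {VNode w, ENode d} \<longleftrightarrow> v = w \<and> e = d"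
  "{FNode f, ENode e} = {FNode h, ENode d} \<longleftrightarrow> f = h \<and> e = d"
  "{VNode v, ENode e} \<noteq> {FNode f, ENode d}"
  "{FNode f, ENode e} \<noteq> {VNode v, ENode d}"
  by (simp_all add: doubleton_eq_iff)

lemma link_in_matching_of [simp]:
  "{VNode v, ENode e} \<in> matching_of V F p q \<longleftrightarrow> v \<in> V \<and> e = p v"
  "{FNode f, ENode e} \<in> matching_of V F p q \<longleftrightarrow> f \<in> F \<and> e = q f"
  by (auto simp: matching_of_def image_iff)

lemma matching_ofE:
  assumes "L \<in> matching_of V F p q"
  obtains v where "v \<in> V" "L = {VNode v, ENode (p v)}" | f where "f \<in> F" "L = {FNode f, ENode (q f)}"
  using assms unfolding matching_of_def by blast

lemma matching_of_eqD:
  assumes "matching_of V F p q = matching_of V F p' q'"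
  shows "v \<in> V \<Longrightarrow> p v = p' v" "f \<in> F \<Longrightarrow> q f = q' f"
  using link_in_matching_of[of _ _ V F p q] link_in_matching_of[of _ _ V F p' q'] assms by metis+

section \<open>Perfect matchings as pairs of partner functions\<close>

locale rooted_plane_graph = plane_graph G for G :: "'e plane_digraph" +
  fixes keep0 :: bool and vs :: complex and fs :: "complex set"
  assumes vs: "vs \<in> verts G" and fs: "fs \<in> faces G"
begin

abbreviation "H \<equiv> vef_graph_minus keep0 G vs fs"
abbreviation "V' \<equiv> verts G - {vs}"
abbreviation "F' \<equiv> faces G - {fs}"

text \<open>These are the codes of perfect matchings. Injectivity with disjoint images covering
  \<open>edges G\<close> says that each edge node is matched exactly once; face links have weight 1
  and thus survive either convention on weight zero.\<close>

definition good :: "(complex \<Rightarrow> 'e) \<Rightarrow> (complex set \<Rightarrow> 'e) \<Rightarrow> bool" where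
  "good p q \<longleftrightarrow> inj_on p V' \<and> inj_on q F' \<and> p ` V' \<inter> q ` F' = {} \<and> p ` V' \<union> q ` F' = edges G \<and>
     (\<forall>v\<in>V'. v \<in> ends G (p v) \<and> (keep0 \<or> vef_weight G {VNode v, ENode (p v)} \<noteq> 0)) \<and>
     (\<forall>f\<in>F'. f \<in> sides G (q f))"

lemma H_simps [simp]:
  "link_weight H = vef_weight G"
  "nodes H = VNode ` V' \<union> ENode ` edges G \<union> FNode ` F'"
  by (auto simp: vef_graph_minus_def vef_graph_def delete_nodes_def)

lemma links_H: "L \<in> links H \<longleftrightarrow>
    (\<exists>v e. L = {VNode v, ENode e} \<and> e \<in> edges G \<and> v \<in> V' \<and> v \<in> ends G e \<and> (keep0 \<or> vef_weight G L \<noteq> 0)) \<or>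
    (\<exists>f e. L = {FNode f, ENode e} \<and> e \<in> edges G \<and> f \<in> F' \<and> f \<in> sides G e)"
proof -
  have disj: "{VNode v, ENode e} \<inter> {VNode vs, FNode fs} = {} \<longleftrightarrow> v \<noteq> vs"
    "{FNode f, ENode e} \<inter> {VNode vs, FNode fs} = {} \<longleftrightarrow> f \<noteq> fs" for v f e by auto
  have "L \<in> links H \<longleftrightarrow>
      ((\<exists>e d. L = {VNode (tail G e d), ENode e} \<and> e \<in> edges G) \<or>
       (\<exists>f e. L = {FNode f, ENode e} \<and> f \<in> faces G \<and> e \<in> edges G \<and> edge_bounds G e f)) \<and>
      (keep0 \<or> vef_weight G L \<noteq> 0) \<and> L \<inter> {VNode vs, FNode fs} = {}"
    unfolding vef_graph_minus_def delete_nodes_def vef_graph_def by auto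
  also have "\<dots> \<longleftrightarrow>
      (\<exists>e d. L = {VNode (tail G e d), ENode e} \<and> e \<in> edges G \<and> tail G e d \<noteq> vs \<and> (keep0 \<or> vef_weight G L \<noteq> 0)) \<or>
      (\<exists>f e. L = {FNode f, ENode e} \<and> f \<in> faces G \<and> e \<in> edges G \<and> edge_bounds G e f \<and> f \<noteq> fs)"
    using disj vef_weight_face by (metis zero_neq_one)
  also have "\<dots> \<longleftrightarrow> (\<exists>v e. L = {VNode v, ENode e} \<and> e \<in> edges G \<and> v \<in> V' \<and> v \<in> ends G e \<and> (keep0 \<or> vef_weight G L \<noteq> 0)) \<or>
    (\<exists>f e. L = {FNode f, ENode e} \<and> e \<in> edges G \<and> f \<in> F' \<and> f \<in> sides G e)"
  proof -
    have "tail G e d \<in> verts G" if "e \<in> edges G" for e d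
      using ends_subset[OF that] tail_in_ends[of G e d] by blast
    then have "(\<exists>e d. L = {VNode (tail G e d), ENode e} \<and> e \<in> edges G \<and> tail G e d \<noteq> vs \<and> (keep0 \<or> vef_weight G L \<noteq> 0)) \<longleftrightarrow>
      (\<exists>v e. L = {VNode v, ENode e} \<and> e \<in> edges G \<and> v \<in> V' \<and> v \<in> ends G e \<and> (keep0 \<or> vef_weight G L \<noteq> 0))"
      unfolding in_ends_iff by blast
    then show ?thesis unfolding sides_def by blast
  qed
  finally show ?thesis .
qed

lemma matching_of_perfect:
  assumes "good p q"
  shows "matching_of V' F' p q \<in> perfect_matchings H"
proof -
  have inj: "inj_on p V'" "inj_on q F'" "p ` V' \<inter> q ` F' = {}" "p ` V' \<union> q ` F' = edges G"
    and inc: "\<And>v. v \<in> V' \<Longrightarrow> v \<in> ends G (p v) \<and> (keep0 \<or> vef_weight G {VNode v, ENode (p v)} \<noteq> 0)"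
      "\<And>f. f \<in> F' \<Longrightarrow> f \<in> sides G (q f)"
    using assms by (auto simp: good_def)
  let ?M = "matching_of V' F' p q"
  have "L \<in> links H" if "L \<in> ?M" for L
  proof -
    from that show ?thesis
    proof (cases rule: matching_ofE)
      case (1 v)
      have "p v \<in> edges G" unfolding inj(4)[symmetric] using 1(1) by (rule UnI1[OF imageI])
      then show ?thesis using 1(1) inc(1)[OF 1(1)] unfolding links_H 1(2) by simp
    next
      case (2 f)
      have "q f \<in> edges G" unfolding inj(4)[symmetric] using 2(1) by (rule UnI2[OF imageI])
      then show ?thesis using 2(1) inc(2)[OF 2(1)] unfolding links_H 2(2) by simp
    qed
  qed
  moreover have "\<exists>!L. L \<in> ?M \<and> x \<in> L" if x: "x \<in> nodes H" for x
  proof -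
    from x consider v where "v \<in> V'" "x = VNode v" | f where "f \<in> F'" "x = FNode f"
      | v where "v \<in> V'" "x = ENode (p v)" | f where "f \<in> F'" "x = ENode (q f)"
      unfolding H_simps inj(4)[symmetric] by blast
    then show ?thesis
    proof cases
      case 1
      then show ?thesis by (intro ex1I[of _ "{VNode v, ENode (p v)}"]) (auto elim!: matching_ofE)
    next
      case 2
      then show ?thesis by (intro ex1I[of _ "{FNode f, ENode (q f)}"]) (auto elim!: matching_ofE)
    next
      case 3
      show ?thesis
      proof (rule ex1I[of _ "{VNode v, ENode (p v)}"])
        fix L assume L: "L \<in> ?M \<and> x \<in> L"
        then have "L \<in> ?M" by blast
        then show "L = {VNode v, ENode (p v)}"
        proof (cases rule: matching_ofE)
          case (1 w)
          then have "p w = p v" using L 3 by simp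
          then have "w = v" using inj_onD[OF inj(1)] 1 3 by blast
          then show ?thesis using 1 by simp
        next
          case (2 f)
          then have "q f = p v" using L 3 by simp
          then show ?thesis using inj(3) 2(1) 3(1) by blast
        qed
      qed (use 3 in simp)
    next
      case 4
      show ?thesis
      proof (rule ex1I[of _ "{FNode f, ENode (q f)}"])
        fix L assume L: "L \<in> ?M \<and> x \<in> L"
        then have "L \<in> ?M" by blast
        then show "L = {FNode f, ENode (q f)}"
        proof (cases rule: matching_ofE)
          case (1 w)
          then have "p w = q f" using L 4 by simp
          then show ?thesis using inj(3) 1(1) 4(1) by blast
        next
          case (2 h)
          then have "q h = q f" using L 4 by simp
          then have "h = f" using inj_onD[OF inj(2)] 2 4 by blast
          then show ?thesis using 2 by simp
        qed
      qed (use 4 in simp)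
    qed
  qed
  ultimately show ?thesis unfolding perfect_matchings_def by blast
qed

text \<open>Every link contains exactly one vertex or face node, so a perfect matching consists
  precisely of the links at those nodes, and the partners there describe it completely.\<close>

lemma perfect_matchingE:
  assumes "M \<in> perfect_matchings H"
  obtains p q where "good p q" "M = matching_of V' F' p q"
proof -
  have in_links: "\<And>L. L \<in> M \<Longrightarrow> L \<in> links H" and ex1: "\<And>x. x \<in> nodes H \<Longrightarrow> \<exists>!L. L \<in> M \<and> x \<in> L"
    using assms unfolding perfect_matchings_def by blast+
  have uniq: "L = L'" if "x \<in> nodes H" "L \<in> M" "L' \<in> M" "x \<in> L" "x \<in> L'" for x L L'
    using ex1[OF that(1)] that by blast
  have "\<exists>e. {VNode v, ENode e} \<in> M" if v: "v \<in> V'" for v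
  proof -
    obtain L where L: "L \<in> M" "VNode v \<in> L" using ex1[of "VNode v"] v by auto
    then show ?thesis using in_links[OF L(1)] unfolding links_H by auto
  qed
  then obtain p where p: "\<And>v. v \<in> V' \<Longrightarrow> {VNode v, ENode (p v)} \<in> M" by metis
  have "\<exists>e. {FNode f, ENode e} \<in> M" if f: "f \<in> F'" for f
  proof -
    obtain L where L: "L \<in> M" "FNode f \<in> L" using ex1[of "FNode f"] f by auto
    then show ?thesis using in_links[OF L(1)] unfolding links_H by auto
  qed
  then obtain q where q: "\<And>f. f \<in> F' \<Longrightarrow> {FNode f, ENode (q f)} \<in> M" by metis
  have M: "M = matching_of V' F' p q"
  proof
    show "matching_of V' F' p q \<subseteq> M" using p q by (auto elim!: matching_ofE)
    show "M \<subseteq> matching_of V' F' p q"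
    proof
      fix L assume L: "L \<in> M"
      then consider v e where "L = {VNode v, ENode e}" "v \<in> V'" | f e where "L = {FNode f, ENode e}" "f \<in> F'"
        using in_links[OF L] unfolding links_H by blast
      then show "L \<in> matching_of V' F' p q"
      proof cases
        case 1
        have "VNode v \<in> nodes H" using 1 by simp
        from uniq[OF this L p[OF 1(2)]] have "L = {VNode v, ENode (p v)}" using 1 by simp
        then show ?thesis using 1(2) by simp
      next
        case 2
        have "FNode f \<in> nodes H" using 2 by simp
        from uniq[OF this L q[OF 2(2)]] have "L = {FNode f, ENode (q f)}" using 2 by simp
        then show ?thesis using 2(2) by simp
      qed
    qed
  qed
  have pE: "p v \<in> edges G \<and> v \<in> ends G (p v) \<and> (keep0 \<or> vef_weight G {VNode v, ENode (p v)} \<noteq> 0)" if "v \<in> V'" for v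
    using in_links[OF p[OF that]] unfolding links_H by simp
  have qE: "q f \<in> edges G \<and> f \<in> sides G (q f)" if "f \<in> F'" for f
    using in_links[OF q[OF that]] unfolding links_H by simp
  have node: "ENode e \<in> nodes H" if "e \<in> edges G" for e using that by simp
  have "good p q"
    unfolding good_def
  proof (intro conjI)
    show "inj_on p V'"
    proof (rule inj_onI)
      fix v w assume vw: "v \<in> V'" "w \<in> V'" "p v = p w"
      then have "{VNode v, ENode (p v)} = {VNode w, ENode (p w)}"
        using uniq[OF node p[OF vw(1)] p[OF vw(2)], of "p v"] pE[OF vw(1)] by simp
      then show "v = w" by simp
    qed
    show "inj_on q F'"
    proof (rule inj_onI)
      fix v w assume vw: "v \<in> F'" "w \<in> F'" "q v = q w"
      then have "{FNode v, ENode (q v)} = {FNode w, ENode (q w)}"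
        using uniq[OF node q[OF vw(1)] q[OF vw(2)], of "q v"] qE[OF vw(1)] by simp
      then show "v = w" by simp
    qed
    have "p v \<noteq> q f" if "v \<in> V'" "f \<in> F'" for v f
    proof
      assume "p v = q f"
      then have "{VNode v, ENode (p v)} = {FNode f, ENode (q f)}"
        using uniq[OF node p[OF that(1)] q[OF that(2)], of "p v"] pE[OF that(1)] by simp
      then show False by simp
    qed
    then show "p ` V' \<inter> q ` F' = {}" by blast
    show "p ` V' \<union> q ` F' = edges G"
    proof
      show "p ` V' \<union> q ` F' \<subseteq> edges G" using pE qE by blast
      show "edges G \<subseteq> p ` V' \<union> q ` F'"
      proof
        fix e assume "e \<in> edges G"
        then obtain L where "L \<in> M" "ENode e \<in> L" using ex1[of "ENode e"] by auto
        then show "e \<in> p ` V' \<union> q ` F'" unfolding M by (auto elim!: matching_ofE)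
      qed
    qed
  qed (use pE qE in auto)
  then show thesis using that M by blast
qed

section \<open>Trees and matchings determine each other\<close>

definition encodes :: "(complex \<Rightarrow> 'e) \<Rightarrow> (complex \<Rightarrow> bool) \<Rightarrow> ('e \<times> bool) set \<Rightarrow> bool" where
  "encodes p \<delta> T \<longleftrightarrow> T = (\<lambda>v. (p v, \<delta> v)) ` V' \<and> (\<forall>v\<in>V'. tail G (p v) (\<delta> v) = v)"

abbreviation "trees \<equiv> spanning_trees keep0 G vs"

lemma treeD:
  assumes "T \<in> trees"
  shows "\<And>e d. (e, d) \<in> T \<Longrightarrow> e \<in> edges G \<and> (keep0 \<or> weight G e d \<noteq> 0) \<and> tail G e d \<in> V'"
    and "contractible (skeleton G (fst ` T))"
    and "\<And>v. v \<in> V' \<Longrightarrow> \<exists>e d. (e, d) \<in> T \<and> tail G e d = v"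
    and "\<And>e d e' d'. (e, d) \<in> T \<Longrightarrow> (e', d') \<in> T \<Longrightarrow> tail G e d = tail G e' d' \<Longrightarrow> e = e' \<and> d = d'"
proof -
  have T: "T \<subseteq> {(e, d). e \<in> edges G \<and> (keep0 \<or> weight G e d \<noteq> 0)}"
    "contractible (verts G \<union> (\<Union>(e, d) \<in> T. path_image (curve G e)))"
    "\<And>v. v \<in> V' \<Longrightarrow> \<exists>!x. case x of (e, d) \<Rightarrow> (e, d) \<in> T \<and> tail G e d = v"
    "\<And>e d. (e, d) \<in> T \<Longrightarrow> tail G e d \<noteq> vs"
    using assms unfolding spanning_trees_def by blast+
  show tl: "e \<in> edges G \<and> (keep0 \<or> weight G e d \<noteq> 0) \<and> tail G e d \<in> V'" if "(e, d) \<in> T" for e d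
    using T(1) T(4)[OF that] that ends_subset[of e] tail_in_ends[of G e d] by blast
  have "skeleton G (fst ` T) = verts G \<union> (\<Union>(e, d) \<in> T. path_image (curve G e))"
    by (auto simp: skeleton_def case_prod_beta)
  then show "contractible (skeleton G (fst ` T))" using T(2) by simp
  show "\<exists>e d. (e, d) \<in> T \<and> tail G e d = v" if "v \<in> V'" for v
    using T(3)[OF that] by blast
  have ex1_eq: "a = b" if "\<exists>!x. P x" "P a" "P b" for P and a b :: "'e \<times> bool" using that by blast
  show "e = e' \<and> d = d'" if "(e, d) \<in> T" "(e', d') \<in> T" "tail G e d = tail G e' d'" for e d e' d'
    using ex1_eq[OF T(3)[of "tail G e d"], of "(e, d)" "(e', d')"] tl[OF that(1)] that by simp
qed

lemma encodes_exists:
  assumes "T \<in> trees"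
  obtains p \<delta> where "encodes p \<delta> T"
proof -
  obtain p \<delta> where p: "\<And>v. v \<in> V' \<Longrightarrow> (p v, \<delta> v) \<in> T \<and> tail G (p v) (\<delta> v) = v"
    using treeD(3)[OF assms] by metis
  have "T \<subseteq> (\<lambda>v. (p v, \<delta> v)) ` V'"
  proof
    fix x assume x: "x \<in> T"
    obtain e d where ed: "x = (e, d)" by fastforce
    let ?v = "tail G e d"
    have v: "?v \<in> V'" using treeD(1)[OF assms] x ed by blast
    then have "x = (p ?v, \<delta> ?v)" using treeD(4)[OF assms, of e d "p ?v" "\<delta> ?v"] p[OF v] x ed by auto
    then show "x \<in> (\<lambda>v. (p v, \<delta> v)) ` V'" using v by blast
  qed
  then show thesis using that[of p \<delta>] p unfolding encodes_def by blast
qed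

lemma encodes_unique:
  assumes "T \<in> trees" "encodes p \<delta> T" "encodes p' \<delta>' T" "v \<in> V'"
  shows "p v = p' v"
  using treeD(4)[OF assms(1), of "p v" "\<delta> v" "p' v" "\<delta>' v"] assms unfolding encodes_def by auto

text \<open>Contractibility gives a connected skeleton, hence the \<open>out_edges\<close>
  situation. From there come injectivity and the absence of loops, and with the latter the agreement
  of link weight and directed edge weight.\<close>

lemma encoded_tree:
  assumes T: "T \<in> trees" "encodes p \<delta> T"
  shows "p ` V' \<subseteq> edges G" "contractible (skeleton G (p ` V'))"
    "inj_on p V'" "\<And>v. v \<in> V' \<Longrightarrow> v \<in> ends G (p v)"
    "\<And>v. v \<in> V' \<Longrightarrow> tail G (p v) (\<delta> v) \<noteq> tail G (p v) (\<not> \<delta> v)"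
    "\<And>v. v \<in> V' \<Longrightarrow> vef_weight G {VNode v, ENode (p v)} = weight G (p v) (\<delta> v)"
proof -
  have tl: "tail G (p v) (\<delta> v) = v" if "v \<in> V'" for v using T(2) that by (simp add: encodes_def)
  have fst: "fst ` T = p ` V'" using T(2) by (auto simp: encodes_def image_image)
  show sub: "p ` V' \<subseteq> edges G" using treeD(1)[OF T(1)] fst by force
  show con: "contractible (skeleton G (p ` V'))" using treeD(2)[OF T(1)] fst by simp
  show inc: "v \<in> ends G (p v)" if "v \<in> V'" for v using tail_in_ends[of G "p v" "\<delta> v"] tl[OF that] by simp
  interpret O: out_edges "verts G" "p ` V'" "ends G" vs p
    using connected_skeleton_imp_cut_connected[OF sub contractible_imp_connected[OF con]]
      vs sub ends_subset ends_pair inc by unfold_locales blast+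
  show "inj_on p V'" by (rule O.inj_out)
  show ne: "tail G (p v) (\<delta> v) \<noteq> tail G (p v) (\<not> \<delta> v)" if v: "v \<in> V'" for v
  proof -
    obtain m where "m \<noteq> v" "ends G (p v) = {v, m}" using O.out_edge_cases[OF v] by metis
    then show ?thesis using tl[OF v] ends_eq_tails[of G "p v" "\<delta> v"] by auto
  qed
  show "vef_weight G {VNode v, ENode (p v)} = weight G (p v) (\<delta> v)" if v: "v \<in> V'" for v
    using vef_weight_vertex[OF ne[OF v]] tl[OF v] by simp
qed

lemma tree_dual_matching:
  assumes T: "T \<in> trees" "encodes p \<delta> T"
  obtains q where "good p q"
proof -
  note enc = encoded_tree[OF T]
  obtain q where q: "bij_betw q F' (edges G - p ` V')" "\<And>h. h \<in> F' \<Longrightarrow> h \<in> sides G (q h)"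
    using dual_tree[OF enc(1,2) fs] by metis
  have "keep0 \<or> vef_weight G {VNode v, ENode (p v)} \<noteq> 0" if v: "v \<in> V'" for v
    using treeD(1)[OF T(1), of "p v" "\<delta> v"] T(2) enc(6)[OF v] v by (auto simp: encodes_def)
  then have "good p q"
    unfolding good_def using q enc by (auto simp: bij_betw_def)
  then show thesis by (rule that)
qed

text \<open>Once \<open>p\<close> is fixed, the face partners must exhaust the dual tree, where the
  orientation towards \<open>fs\<close> is unique.\<close>

lemma tree_dual_matching_unique:
  assumes T: "T \<in> trees" "encodes p \<delta> T" and "good p q" "good p q'" "f \<in> F'"
  shows "q f = q' f"
proof -
  note enc = encoded_tree[OF T]
  have img: "k ` F' = edges G - p ` V'" if "good p k" for k using that unfolding good_def by blast
  have conn: "cut_connected (faces G) (edges G - p ` V') (sides G)"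
    using dual_tree[OF enc(1,2) fs] by metis
  interpret O: out_edges "faces G" "edges G - p ` V'" "sides G" fs q'
    using conn fs sides_subset sides_pair img[OF assms(4)] assms(4)
    by unfold_locales (auto simp: good_def)
  show ?thesis by (rule O.out_unique) (use img[OF assms(3)] assms in \<open>auto simp: good_def\<close>)
qed

lemma weights_agree:
  assumes T: "T \<in> trees" "encodes p \<delta> T" and good: "good p q"
  shows "matching_weight H (matching_of V' F' p q) = tree_weight G T"
proof -
  note enc = encoded_tree[OF T]
  let ?v = "\<lambda>v. {VNode v, ENode (p v)}" and ?f = "\<lambda>f. {FNode f, ENode (q f)}"
  have inj: "inj_on ?v V'" "inj_on ?f F'" "?v ` V' \<inter> ?f ` F' = {}"
    by (auto simp: inj_on_def)
  have "q ` F' \<subseteq> edges G" "inj_on q F'" using good unfolding good_def by blast+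
  then have "finite F'" using finite_edges inj_on_finite by blast
  then have fin: "finite V'" "finite F'" using finite_verts by auto
  have "matching_weight H (matching_of V' F' p q) = (\<Prod>L\<in>?v ` V'. vef_weight G L) * (\<Prod>L\<in>?f ` F'. vef_weight G L)"
    unfolding matching_weight_def matching_of_def using fin inj(3) by (simp add: prod.union_disjoint)
  also have "\<dots> = (\<Prod>v\<in>V'. vef_weight G (?v v)) * (\<Prod>f\<in>F'. vef_weight G (?f f))"
    by (simp only: prod.reindex[OF inj(1)] prod.reindex[OF inj(2)] o_def)
  also have "\<dots> = (\<Prod>v\<in>V'. weight G (p v) (\<delta> v))"
    using enc(6) by simp
  also have "\<dots> = (\<Prod>(e, d)\<in>(\<lambda>v. (p v, \<delta> v)) ` V'. weight G e d)"
    using enc(3) by (subst prod.reindex) (auto simp: inj_on_def)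
  also have "\<dots> = tree_weight G T" using T(2) by (simp add: tree_weight_def encodes_def)
  finally show ?thesis .
qed

text \<open>The vertex partners form a spanning tree by the Euler count, and each is directed so as
  to start at the vertex it is matched with.\<close>

lemma matching_gives_tree:
  assumes conn: "graph_connected G" and inc: "vs \<in> frontier fs" and good: "good p q"
  obtains T \<delta> where "T \<in> trees" "encodes p \<delta> T"
proof -
  let ?A = "p ` V'"
  have p: "inj_on p V'" "?A \<subseteq> edges G" "\<And>v. v \<in> V' \<Longrightarrow> v \<in> ends G (p v)"
    and q: "inj_on q F'" "q ` F' \<subseteq> edges G - ?A" "\<And>f. f \<in> F' \<Longrightarrow> f \<in> sides G (q f)"
    using good unfolding good_def by blast+
  have cc: "cut_connected (verts G) ?A (ends G)"
    using matching_imp_connected[OF graph_connected_imp_cut_connected[OF conn] vs fs inc p(2) p(1) refl p(3) q] .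
  have con: "contractible (skeleton G ?A)" by (rule contractible_tree[OF p(2) cc vs refl p(3)])
  interpret O: out_edges "verts G" ?A "ends G" vs p
    using cc vs p ends_subset ends_pair by unfold_locales blast+
  have "\<exists>d. tail G (p v) d = v" if "v \<in> V'" for v
    using p(3)[OF that] unfolding in_ends_iff by metis
  then obtain \<delta> where \<delta>: "\<And>v. v \<in> V' \<Longrightarrow> tail G (p v) (\<delta> v) = v" by metis
  let ?T = "(\<lambda>v. (p v, \<delta> v)) ` V'"
  \<comment> \<open>A nonzero link weight is a maximum over directions in general; that it is the
    weight of the chosen direction relies on the edge not being a loop.\<close>
  have "weight G (p v) (\<delta> v) \<noteq> 0" if v: "v \<in> V'" "\<not> keep0" for v
  proof -
    obtain m where "m \<noteq> v" "ends G (p v) = {v, m}" using O.out_edge_cases[OF v(1)] by metis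
    then have "tail G (p v) (\<delta> v) \<noteq> tail G (p v) (\<not> \<delta> v)"
      using \<delta>[OF v(1)] ends_eq_tails[of G "p v" "\<delta> v"] by auto
    then have "weight G (p v) (\<delta> v) = vef_weight G {VNode v, ENode (p v)}"
      using vef_weight_vertex \<delta>[OF v(1)] by metis
    moreover have "vef_weight G {VNode v, ENode (p v)} \<noteq> 0"
      using good v unfolding good_def by blast
    ultimately show ?thesis by simp
  qed
  moreover have "verts G \<union> (\<Union>(e, d) \<in> ?T. path_image (curve G e)) = skeleton G ?A"
    by (auto simp: skeleton_def)
  moreover have "\<exists>!x. case x of (e, d) \<Rightarrow> (e, d) \<in> ?T \<and> tail G e d = v" if "v \<in> V'" for v
  proof (intro ex1I[of _ "(p v, \<delta> v)"])
    fix x assume "case x of (e, d) \<Rightarrow> (e, d) \<in> ?T \<and> tail G e d = v"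
    then obtain w where "w \<in> V'" "x = (p w, \<delta> w)" "tail G (p w) (\<delta> w) = v" by auto
    then show "x = (p v, \<delta> v)" using \<delta>[of w] by simp
  qed (use that \<delta> in auto)
  ultimately have "?T \<in> trees"
    unfolding spanning_trees_def
    using con contractible_imp_connected[OF con] p(2) \<delta> by auto
  moreover have "encodes p \<delta> ?T" using \<delta> by (simp add: encodes_def)
  ultimately show thesis by (rule that)
qed

definition dual_pair :: "('e \<times> bool) set \<Rightarrow> 'e node set set \<Rightarrow> bool" where
  "dual_pair T M \<longleftrightarrow> (\<exists>p \<delta> q. encodes p \<delta> T \<and> good p q \<and> M = matching_of V' F' p q)"

text \<open>The choice is harmless: a tree has exactly one dual matching, by
  \<open>dual_pair_unique\<close>.\<close>

definition tree_to_matching :: "('e \<times> bool) set \<Rightarrow> 'e node set set" where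
  "tree_to_matching T = (SOME M. dual_pair T M)"

lemma dual_pair_matching: "T \<in> trees \<Longrightarrow> dual_pair T (tree_to_matching T)"
  unfolding tree_to_matching_def
  by (rule someI_ex) (metis dual_pair_def encodes_exists tree_dual_matching)

lemma dual_pair_unique:
  assumes "T \<in> trees" "dual_pair T M" "dual_pair T M'"
  shows "M = M'"
proof -
  obtain p \<delta> q p' \<delta>' q' where pq: "encodes p \<delta> T" "good p q" "M = matching_of V' F' p q"
    "encodes p' \<delta>' T" "good p' q'" "M' = matching_of V' F' p' q'"
    using assms(2,3) unfolding dual_pair_def by metis
  have eq: "p' v = p v" if "v \<in> V'" for v using encodes_unique[OF assms(1) pq(4,1) that] .
  have "inj_on p' V' = inj_on p V'" by (rule inj_on_cong) (rule eq)
  moreover have "p' ` V' = p ` V'" by (rule image_cong) (auto simp: eq)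
  ultimately have "good p q'" using pq(5) eq unfolding good_def by simp
  then have "q f = q' f" if "f \<in> F'" for f using tree_dual_matching_unique[OF assms(1) pq(1,2) _ that] by blast
  then show ?thesis unfolding pq matching_of_def using eq by simp
qed

text \<open>A matching remembers edges but not directions. The direction is recovered because the
  tail has to be the matched vertex and the edge is not a loop.\<close>

lemma dual_pair_inj:
  assumes "T \<in> trees" "T' \<in> trees" "dual_pair T M" "dual_pair T' M"
  shows "T = T'"
proof -
  obtain p \<delta> q p' \<delta>' q' where pq: "encodes p \<delta> T" "M = matching_of V' F' p q"
    "encodes p' \<delta>' T'" "M = matching_of V' F' p' q'"
    using assms(3,4) unfolding dual_pair_def by metis
  have "(p v, \<delta> v) = (p' v, \<delta>' v)" if v: "v \<in> V'" for v
  proof -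
    have "p v = p' v" using matching_of_eqD(1)[of V' F' p q p' q'] pq v by simp
    moreover have "tail G (p v) (\<delta> v) = v" "tail G (p' v) (\<delta>' v) = v"
      using pq v by (auto simp: encodes_def)
    moreover note encoded_tree(5)[OF assms(1) pq(1) v]
    ultimately show ?thesis by (cases "\<delta> v"; cases "\<delta>' v") auto
  qed
  then show ?thesis using pq unfolding encodes_def by simp
qed

lemma inj_tree_to_matching: "inj_on tree_to_matching trees"
  by (rule inj_onI) (metis dual_pair_inj dual_pair_matching)

lemma tree_to_matching_perfect: "tree_to_matching ` trees \<subseteq> perfect_matchings H"
  using dual_pair_matching matching_of_perfect unfolding dual_pair_def by fastforce

lemma tree_to_matching_weight: "T \<in> trees \<Longrightarrow> matching_weight H (tree_to_matching T) = tree_weight G T"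
  using dual_pair_matching weights_agree unfolding dual_pair_def by metis

text \<open>A matching yields a tree with the same vertex partners; by uniqueness the face partners
  agree too, so the tree is sent back to the given matching.\<close>

lemma tree_to_matching_onto:
  assumes "graph_connected G" "vs \<in> frontier fs"
  shows "perfect_matchings H \<subseteq> tree_to_matching ` trees"
proof
  fix M assume "M \<in> perfect_matchings H"
  then obtain p q where M: "good p q" "M = matching_of V' F' p q" by (rule perfect_matchingE)
  obtain T \<delta> where T: "T \<in> trees" "encodes p \<delta> T" by (rule matching_gives_tree[OF assms M(1)])
  then have "dual_pair T M" using M unfolding dual_pair_def by blast
  then have "M = tree_to_matching T" using dual_pair_unique dual_pair_matching T(1) by blast
  then show "M \<in> tree_to_matching ` trees" using T(1) by blast
qed

end

theorem theorem1:
  fixes G :: "'e plane_digraph" and vs :: complex and fs :: "complex set" and keep0 :: bool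
  assumes "finite_embedded G"
    and "graph_connected G"
    and "nonneg_weights G"
    and "vs \<in> verts G"
    and "fs \<in> faces G"
  shows "(vertex_incident vs fs \<longrightarrow>
           (\<exists>\<phi>. bij_betw \<phi> (spanning_trees keep0 G vs)
                           (perfect_matchings (vef_graph_minus keep0 G vs fs)) \<and>
                (\<forall>T \<in> spanning_trees keep0 G vs.
                   matching_weight (vef_graph_minus keep0 G vs fs) (\<phi> T) = tree_weight G T))) \<and>
         (\<not> vertex_incident vs fs \<longrightarrow>
           (\<exists>\<phi>. inj_on \<phi> (spanning_trees keep0 G vs) \<and>
                \<phi> ` spanning_trees keep0 G vs
                  \<subseteq> perfect_matchings (vef_graph_minus keep0 G vs fs) \<and>
                (\<forall>T \<in> spanning_trees keep0 G vs.
                   matching_weight (vef_graph_minus keep0 G vs fs) (\<phi> T) = tree_weight G T)))"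
proof -
  interpret rooted_plane_graph G keep0 vs fs
    using assms by unfold_locales
  have "bij_betw tree_to_matching trees (perfect_matchings H)" if "vertex_incident vs fs"
    using inj_tree_to_matching tree_to_matching_perfect tree_to_matching_onto[OF assms(2)] that
    by (auto simp: bij_betw_def vertex_incident_def)
  then show ?thesis
    using inj_tree_to_matching tree_to_matching_perfect tree_to_matching_weight by blast
qed

end
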